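(* Let $k$ be a field with $\operatorname{char}(k)\ne2$. Every GDN superalgebra embeds into its universal enveloping associative differential supercommutative algebra. Precisely: let $X=X_0\sqcup X_1$ be a well-ordered set, $S$ a homogeneous subset of $\mathrm{GDN}_s(X)$, and $\varphi:\mathrm{GDN}_s(X)\to(k_s\{X\},\circ)$ the GDN superalgebra homomorphism with $\varphi(a)=a$ ($a\in X$). Then the natural map $\mathrm{GDN}_s(X)/\mathrm{Id}(S)\to k_s\{X\}/\mathrm{Id}_D[\varphi(S)]$ induced by $\varphi$ is an injective homomorphism of GDN superalgebras, where $\mathrm{Id}(S)$ is the GDN superalgebra ideal of $\mathrm{GDN}_s(X)$ generated by $S$, $\mathrm{Id}_D[\varphi(S)]$ is the differential ideal (ideal closed under $D$) of $k_s\{X\}$ generated by $\varphi(S)$, and both quotients carry the product $u\circ v=u\cdot D(v)$ on the target.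
   Context: A superalgebra over $k$ is a vector space $\mathcal A=\mathcal A_0\oplus\mathcal A_1$ with a bilinear product $\circ$ such that $\mathcal A_i\circ\mathcal A_j\subseteq\mathcal A_{i+j}$ (indices mod 2); for nonzero $x\in\mathcal A_i$ write $|x|=i$. A (left) GDN superalgebra is a superalgebra satisfying, for all homogeneous $x,y,z$: $x\circ(y\circ z)-(x\circ y)\circ z=(-1)^{|x||y|}(y\circ(x\circ z)-(y\circ x)\circ z)$ and $(x\circ y)\circ z=(-1)^{|y||z|}(x\circ z)\circ y$. $\mathrm{GDN}_s(X)$ is the free GDN superalgebra on $X=X_0\sqcup X_1$ (elements of $X_i$ of parity $i$). A subset is homogeneous if it is contained in $\mathcal A_0\cup\mathcal A_1$; every GDN superalgebra is of the form $\mathrm{GDN}_s(X)/\mathrm{Id}(S)$ for such $X,S$. An associative differential supercommutative algebra is an associative superalgebra $(\mathcal A,\cdot)$ with $x\cdot y=(-1)^{|x||y|}y\cdot x$ for homogeneous $x,y$, and a parity-preserving linear derivation $D$ ($D(x\cdot y)=Dx\cdot y+x\cdot Dy$). $k_s\{X\}$ is the free such algebra on $X$. For such an algebra, $x\circ y:=x\cdot D(y)$ defines a GDN superalgebra structure. The universal enveloping associative differential supercommutative algebra of a GDN superalgebra $\mathcal A$ is an associative differential supercommutative algebra $\mathcal B$ with a parity-preserving linear map $\psi:\mathcal A\to\mathcal B$ satisfying $\psi(x\circ y)=\psi(x)\cdot D(\psi(y))$, universal among such maps; for $\mathcal A=\mathrm{GDN}_s(X)/\mathrm{Id}(S)$ it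 is $k_s\{X\}/\mathrm{Id}_D[\varphi(S)]$. *)

theory Defs
  imports Main "HOL-Library.Poly_Mapping"
begin

definition lsmult :: "'k::field \<Rightarrow> ('t \<Rightarrow>\<^sub>0 'k) \<Rightarrow> ('t \<Rightarrow>\<^sub>0 'k)" where
  "lsmult c f = Poly_Mapping.map (\<lambda>v. c * v) f"

definition bilin_ext :: "('s \<Rightarrow> 's \<Rightarrow> 's) \<Rightarrow> ('s \<Rightarrow>\<^sub>0 'k::field) \<Rightarrow> ('s \<Rightarrow>\<^sub>0 'k) \<Rightarrow> ('s \<Rightarrow>\<^sub>0 'k)" where
  "bilin_ext op f g =
     (\<Sum>s\<in>Poly_Mapping.keys f. \<Sum>t\<in>Poly_Mapping.keys g. Poly_Mapping.single (op s t) (Poly_Mapping.lookup f s * Poly_Mapping.lookup g t))"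

definition lin_ext :: "('s \<Rightarrow> ('t \<Rightarrow>\<^sub>0 'k::field)) \<Rightarrow> ('s \<Rightarrow>\<^sub>0 'k) \<Rightarrow> ('t \<Rightarrow>\<^sub>0 'k)" where
  "lin_ext h f = (\<Sum>s\<in>Poly_Mapping.keys f. lsmult (Poly_Mapping.lookup f s) (h s))"

text \<open>Homogeneous of parity i (True = odd) w.r.t. a parity function on basis elements.\<close>
definition homog :: "('t \<Rightarrow> bool) \<Rightarrow> bool \<Rightarrow> ('t \<Rightarrow>\<^sub>0 'k::zero) \<Rightarrow> bool" where
  "homog tpar i f \<longleftrightarrow> (\<forall>t\<in>Poly_Mapping.keys f. tpar t = i)"

text \<open>Sign (-1)^(|x||y|) applied to an element.\<close>
definition ssign :: "bool \<Rightarrow> bool \<Rightarrow> ('t \<Rightarrow>\<^sub>0 'k::field) \<Rightarrow> ('t \<Rightarrow>\<^sub>0 'k)" where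
  "ssign a b f = (if a \<and> b then - f else f)"

text \<open>Ideal generated by G in an algebra (product mul, carrier C) that is moreover
  closed under every linear operator in ops (ops = {} gives ordinary two-sided ideals,
  ops = {D} gives differential ideals).\<close>
inductive_set gen_ideal :: "(('t \<Rightarrow>\<^sub>0 'k::field) \<Rightarrow> ('t \<Rightarrow>\<^sub>0 'k) \<Rightarrow> ('t \<Rightarrow>\<^sub>0 'k))
   \<Rightarrow> (('t \<Rightarrow>\<^sub>0 'k) \<Rightarrow> ('t \<Rightarrow>\<^sub>0 'k)) set \<Rightarrow> ('t \<Rightarrow>\<^sub>0 'k) set \<Rightarrow> ('t \<Rightarrow>\<^sub>0 'k) set
   \<Rightarrow> ('t \<Rightarrow>\<^sub>0 'k) set"
  for mul ops C G where
  gen: "g \<in> G \<Longrightarrow> g \<in> gen_ideal mul ops C G"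
| zero: "0 \<in> gen_ideal mul ops C G"
| add: "u \<in> gen_ideal mul ops C G \<Longrightarrow> v \<in> gen_ideal mul ops C G \<Longrightarrow> u + v \<in> gen_ideal mul ops C G"
| smult: "u \<in> gen_ideal mul ops C G \<Longrightarrow> lsmult c u \<in> gen_ideal mul ops C G"
| lmul: "u \<in> gen_ideal mul ops C G \<Longrightarrow> a \<in> C \<Longrightarrow> mul a u \<in> gen_ideal mul ops C G"
| rmul: "u \<in> gen_ideal mul ops C G \<Longrightarrow> a \<in> C \<Longrightarrow> mul u a \<in> gen_ideal mul ops C G"
| oper: "u \<in> gen_ideal mul ops C G \<Longrightarrow> d \<in> ops \<Longrightarrow> d u \<in> gen_ideal mul ops C G"

section \<open>Free GDN superalgebra GDN_s(X) = free nonassociative algebra / GDN identities\<close>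

datatype 'x mag = MLeaf 'x | MNode "'x mag" "'x mag"

primrec mpar :: "('x \<Rightarrow> bool) \<Rightarrow> 'x mag \<Rightarrow> bool" where
  "mpar par (MLeaf x) = par x"
| "mpar par (MNode s t) = (mpar par s \<noteq> mpar par t)"

definition mag_alg :: "'x set \<Rightarrow> ('x mag \<Rightarrow>\<^sub>0 'k::field) set" where
  "mag_alg X = {f. \<forall>t\<in>Poly_Mapping.keys f. set_mag t \<subseteq> X}"

definition mmul :: "('x mag \<Rightarrow>\<^sub>0 'k::field) \<Rightarrow> ('x mag \<Rightarrow>\<^sub>0 'k) \<Rightarrow> ('x mag \<Rightarrow>\<^sub>0 'k)" where
  "mmul = bilin_ext MNode"

definition mhom :: "('x \<Rightarrow> bool) \<Rightarrow> bool \<Rightarrow> ('x mag \<Rightarrow>\<^sub>0 'k::field) \<Rightarrow> bool" where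
  "mhom par i f = homog (mpar par) i f"

definition gdn_rel :: "'x set \<Rightarrow> ('x \<Rightarrow> bool) \<Rightarrow> ('x mag \<Rightarrow>\<^sub>0 'k::field) set" where
  "gdn_rel X par = {r. \<exists>x y z a b c.
      x \<in> mag_alg X \<and> y \<in> mag_alg X \<and> z \<in> mag_alg X \<and>
      mhom par a x \<and> mhom par b y \<and> mhom par c z \<and>
      (r = mmul x (mmul y z) - mmul (mmul x y) z
            - ssign a b (mmul y (mmul x z) - mmul (mmul y x) z)
     \<or> r = mmul (mmul x y) z - ssign b c (mmul (mmul x z) y))}"

text \<open>Preimage in k[X] of the ideal Id(S) of GDN_s(X), for S given by (homogeneous)
  representatives: the ideal of k[X] generated by the GDN relators and S.\<close>
definition gdn_Id :: "'x set \<Rightarrow> ('x \<Rightarrow> bool) \<Rightarrow> ('x mag \<Rightarrow>\<^sub>0 'k::field) set \<Rightarrow> ('x mag \<Rightarrow>\<^sub>0 'k) set" where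
  "gdn_Id X par S = gen_ideal mmul {} (mag_alg X) (gdn_rel X par \<union> S)"

datatype 'x dterm = DLeaf 'x | DMul "'x dterm" "'x dterm" | DDer "'x dterm"

primrec dpar :: "('x \<Rightarrow> bool) \<Rightarrow> 'x dterm \<Rightarrow> bool" where
  "dpar par (DLeaf x) = par x"
| "dpar par (DMul s t) = (dpar par s \<noteq> dpar par t)"
| "dpar par (DDer s) = dpar par s"

definition dterm_alg :: "'x set \<Rightarrow> ('x dterm \<Rightarrow>\<^sub>0 'k::field) set" where
  "dterm_alg X = {f. \<forall>t\<in>Poly_Mapping.keys f. set_dterm t \<subseteq> X}"

definition dmul :: "('x dterm \<Rightarrow>\<^sub>0 'k::field) \<Rightarrow> ('x dterm \<Rightarrow>\<^sub>0 'k) \<Rightarrow> ('x dterm \<Rightarrow>\<^sub>0 'k)" where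
  "dmul = bilin_ext DMul"

definition dder :: "('x dterm \<Rightarrow>\<^sub>0 'k::field) \<Rightarrow> ('x dterm \<Rightarrow>\<^sub>0 'k)" where
  "dder = lin_ext (\<lambda>t. Poly_Mapping.single (DDer t) 1)"

definition dhom :: "('x \<Rightarrow> bool) \<Rightarrow> bool \<Rightarrow> ('x dterm \<Rightarrow>\<^sub>0 'k::field) \<Rightarrow> bool" where
  "dhom par i f = homog (dpar par) i f"

definition ads_rel :: "'x set \<Rightarrow> ('x \<Rightarrow> bool) \<Rightarrow> ('x dterm \<Rightarrow>\<^sub>0 'k::field) set" where
  "ads_rel X par = {r. \<exists>u v w a b.
      u \<in> dterm_alg X \<and> v \<in> dterm_alg X \<and> w \<in> dterm_alg X \<and>
      dhom par a u \<and> dhom par b v \<and>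
      (r = dmul u (dmul v w) - dmul (dmul u v) w
     \<or> r = dmul u v - ssign a b (dmul v u)
     \<or> r = dder (dmul u v) - dmul (dder u) v - dmul u (dder v))}"

text \<open>Preimage in the free term algebra of the differential ideal Id_D[T] of k_s{X}
  (T given by representatives).\<close>
definition ads_IdD :: "'x set \<Rightarrow> ('x \<Rightarrow> bool) \<Rightarrow> ('x dterm \<Rightarrow>\<^sub>0 'k::field) set \<Rightarrow> ('x dterm \<Rightarrow>\<^sub>0 'k) set" where
  "ads_IdD X par T = gen_ideal dmul {dder} (dterm_alg X) (ads_rel X par \<union> T)"

primrec phi_t :: "'x mag \<Rightarrow> ('x dterm \<Rightarrow>\<^sub>0 'k::field)" where
  "phi_t (MLeaf x) = Poly_Mapping.single (DLeaf x) 1"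
| "phi_t (MNode s t) = dmul (phi_t s) (dder (phi_t t))"

definition phi :: "('x mag \<Rightarrow>\<^sub>0 'k::field) \<Rightarrow> ('x dterm \<Rightarrow>\<^sub>0 'k)" where
  "phi = lin_ext phi_t"

end

theory Submission
  imports Defs "HOL.Vector_Spaces"
begin

text \<open>
  Only the injectivity is not formal. Let \<open>A\<close> be a GDN superalgebra and give a monomial in letters
  \<open>D\<^sup>ka\<close> (\<open>a\<close> in \<open>A\<close>) the weight \<open>\<Sum>(k - 1)\<close>. It suffices to have a linear functional \<open>\<Phi>\<close> on words of weight \<open>-1\<close>
  with values in \<open>A\<close> that is supersymmetric, sends the word \<open>a\<close> to \<open>a\<close>, and satisfies \<open>\<Phi>(y D(w)) = y \<circ> \<Phi>(w)\<close>:
  such a functional annihilates the differential ideal.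

  Left-symmetry says that the symmetric braces \<open>y\<^sub>1 \<cdots> y\<^sub>n D\<^sup>na\<close> of Oudom and Guin are well defined in \<open>A\<close> and
  supersymmetric in the \<open>y\<^sub>i\<close>. Omitting one \<open>y\<^sub>i\<close> turns them into operators that represent multiplication by
  monomials of weight \<open>0\<close>. These operators lie in the algebra generated by the right multiplications, which is
  supercommutative by the second GDN identity. A word of weight \<open>-1\<close> is a product of such operators applied to one
  remaining letter of \<open>A\<close>. Any two underived letters may be exchanged, because a brace is symmetric in all of its
  arguments and the operators commute, so the value does not depend on how the word is split.

  To transport \<open>\<Phi>\<close> to the free differential algebra, let differential terms act on functionals on words, a generator
  by prepending a letter and \<open>D\<close> through the commutator with the derivation.
\<close>

subsection \<open>Signs and list functionals\<close>

text \<open>The exponent of \<open>-1\<close> is kept as one boolean, so that signs compose by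
  \<open>\<noteq>\<close>, which is addition modulo 2.\<close>

definition sg :: "bool \<Rightarrow> 'v::ab_group_add \<Rightarrow> 'v" where
  "sg b f = (if b then - f else f)"

lemma sg_simps [simp]:
  "sg False f = f" "sg True f = - f" "sg b 0 = 0"
  "sg a (sg b f) = sg (a \<noteq> b) f" "sg b (- f) = - sg b f"
  by (auto simp: sg_def)

lemma sg_add: "sg b (f + g) = sg b f + sg b g"
  and sg_diff: "sg b (f - g) = sg b f - sg b g"
  by (auto simp: sg_def)

lemma sg_eq_flip: "f = sg b g \<longleftrightarrow> g = sg b f"
proof (cases b)
  case True
  then show ?thesis using equation_minus_iff[of f g] by (simp only: sg_simps)
qed (simp add: eq_commute)

text \<open>Swaps of neighbours generate all permutations, so this is supersymmetry in all letters,
  for words of every length at once.\<close>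

definition supersym :: "('c \<Rightarrow> bool) \<Rightarrow> ('c list \<Rightarrow> 'v::ab_group_add) \<Rightarrow> bool" where
  "supersym q H \<longleftrightarrow> (\<forall>u y z v. H (u @ y # z # v) = sg (q y \<and> q z) (H (u @ z # y # v)))"

lemma supersymD: "supersym q H \<Longrightarrow> H (u @ y # z # v) = sg (q y \<and> q z) (H (u @ z # y # v))"
  unfolding supersym_def by blast

primrec lpar :: "('c \<Rightarrow> bool) \<Rightarrow> 'c list \<Rightarrow> bool" where
  "lpar q [] = False"
| "lpar q (c # w) = (q c \<noteq> lpar q w)"

lemma lpar_append [simp]: "lpar q (u @ v) = (lpar q u \<noteq> lpar q v)"
  by (induction u) auto

lemma sg_cong: "a = b \<Longrightarrow> sg a f = sg b f"
  by simp

lemma supersym_move: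
  assumes "supersym q H"
  shows "H (u @ z # v @ w) = sg (q z \<and> lpar q v) (H (u @ v @ z # w))"
proof (induction v arbitrary: u)
  case (Cons y v)
  have "H (u @ z # (y # v) @ w) = sg (q z \<and> q y) (H ((u @ [y]) @ z # v @ w))"
    using supersymD[OF assms, of u z y "v @ w"] by simp
  also have "\<dots> = sg (q z \<and> q y) (sg (q z \<and> lpar q v) (H ((u @ [y]) @ v @ z # w)))"
    by (subst Cons.IH) (rule refl)
  finally show ?case
    by (rule trans) (simp, rule sg_cong, auto)
qed simp

lemma supersym_swap:
  assumes "supersym q H"
  shows "H (u @ v @ w) = sg (lpar q u \<and> lpar q v) (H (v @ u @ w))"
proof (induction u arbitrary: w)
  case (Cons z u)
  have "H ((z # u) @ v @ w) = sg (q z \<and> lpar q (u @ v)) (H ([] @ (u @ v) @ z # w))"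
    using supersym_move[OF assms, of "[]" z "u @ v" w] by simp
  also have "H ([] @ (u @ v) @ z # w) = sg (lpar q u \<and> lpar q v) (H (v @ u @ z # w))"
    using Cons.IH[of "z # w"] by simp
  also have "H (v @ u @ z # w) = sg (q z \<and> lpar q u) (H (v @ z # u @ w))"
    using supersym_move[OF assms, of v z u w] by (subst sg_eq_flip)
  finally show ?case
    by (rule trans) (simp, rule sg_cong, auto)
qed simp

text \<open>The vector field \<open>y D\<close> acts on a product of underived letters by
  \<open>y D z = y \<circ> z\<close> in each factor in turn; the sign records \<open>y\<close>
  passing the earlier factors.\<close>

primrec slotsum :: "('x mag \<Rightarrow> bool) \<Rightarrow> 'x mag \<Rightarrow> ('x mag list \<Rightarrow> 'v::ab_group_add) \<Rightarrow> 'x mag list \<Rightarrow> 'v" where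
  "slotsum p y G [] = 0"
| "slotsum p y G (z # Y) = G (MNode y z # Y) + sg (p y \<and> p z) (slotsum p y (\<lambda>Y. G (z # Y)) Y)"

lemma slotsum_cong:
  assumes "\<And>Y'. length Y' = length Y \<Longrightarrow> lpar (mpar par) Y' = (lpar (mpar par) Y \<noteq> mpar par y) \<Longrightarrow> G Y' = G' Y'"
  shows "slotsum (mpar par) y G Y = slotsum (mpar par) y G' Y"
  using assms
proof (induction Y arbitrary: G G')
  case (Cons z Y)
  have "G (MNode y z # Y) = G' (MNode y z # Y)"
    by (rule Cons.prems) auto
  moreover have "slotsum (mpar par) y (\<lambda>Y. G (z # Y)) Y = slotsum (mpar par) y (\<lambda>Y. G' (z # Y)) Y"
    by (rule Cons.IH, rule Cons.prems) auto
  ultimately show ?case by simp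
qed simp

lemma slotsum_zero [simp]: "slotsum p y (\<lambda>Y. 0) Y = 0"
  by (induction Y) simp_all

lemma slotsum_uminus: "slotsum p y (\<lambda>Y. - G Y) Y = - slotsum p y G Y"
  by (induction Y arbitrary: G) simp_all

lemma slotsum_add: "slotsum p y (\<lambda>Y. G Y + G' Y) Y = slotsum p y G Y + slotsum p y G' Y"
  by (induction Y arbitrary: G G') (simp_all add: sg_add algebra_simps)

lemma slotsum_diff: "slotsum p y (\<lambda>Y. G Y - G' Y) Y = slotsum p y G Y - slotsum p y G' Y"
  using slotsum_add[of p y G "\<lambda>Y. - G' Y" Y] by (simp add: slotsum_uminus)

lemma slotsum_sg: "slotsum p y (\<lambda>Y. sg b (G Y)) Y = sg b (slotsum p y G Y)"
  by (cases b) (simp_all add: slotsum_uminus)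

lemma slotsum_append:
  "slotsum p y G (u @ v) =
     slotsum p y (\<lambda>u. G (u @ v)) u + sg (p y \<and> lpar p u) (slotsum p y (\<lambda>v. G (u @ v)) v)"
proof (induction u arbitrary: G)
  case (Cons z u)
  show ?case
    by (simp add: Cons.IH[of "\<lambda>Y. G (z # Y)"] sg_add add.assoc) (rule sg_cong, auto)
qed simp

lemma supersym_slotsum:
  assumes G: "supersym (mpar par) G"
  shows "supersym (mpar par) (slotsum (mpar par) w G)"
  unfolding supersym_def
proof (intro allI)
  let ?p = "mpar par"
  fix u y z v
  have 1: "slotsum ?p w (\<lambda>u. G (u @ y # z # v)) u = sg (?p y \<and> ?p z) (slotsum ?p w (\<lambda>u. G (u @ z # y # v)) u)"
    by (simp add: supersymD[OF G, of _ y z v] slotsum_sg)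
  have 2: "G (u @ MNode w y # z # v) = sg ((?p w \<noteq> ?p y) \<and> ?p z) (G (u @ z # MNode w y # v))"
    using supersymD[OF G, of u "MNode w y" z v] by simp
  have 3: "G (u @ y # MNode w z # v) = sg (?p y \<and> (?p w \<noteq> ?p z)) (G (u @ MNode w z # y # v))"
    using supersymD[OF G, of u y "MNode w z" v] by simp
  have 4: "slotsum ?p w (\<lambda>v. G (u @ y # z # v)) v = sg (?p y \<and> ?p z) (slotsum ?p w (\<lambda>v. G (u @ z # y # v)) v)"
    by (simp add: supersymD[OF G, of u y z] slotsum_sg)
  show "slotsum ?p w G (u @ y # z # v) = sg (?p y \<and> ?p z) (slotsum ?p w G (u @ z # y # v))"
    unfolding slotsum_append[of ?p w G u] slotsum.simps 1 2 3 4
    by (cases "?p y"; cases "?p z"; cases "?p w"; cases "lpar ?p u") simp_all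
qed

text \<open>\<open>G\<close> is a function of trees, so left-symmetry of the algebra is not
  automatic inside a slot; this is the form of it that double slot sums need.\<close>

definition slot_lsym :: "('x mag \<Rightarrow> bool) \<Rightarrow> ('x mag list \<Rightarrow> 'v::ab_group_add) \<Rightarrow> bool" where
  "slot_lsym p G \<longleftrightarrow> (\<forall>u x v y z.
     G (u @ MNode y (MNode z x) # v) - sg (p y \<and> p z) (G (u @ MNode z (MNode y x) # v)) =
     G (u @ MNode (MNode y z) x # v) - sg (p y \<and> p z) (G (u @ MNode (MNode z y) x # v)))"

text \<open>Terms in which \<open>y\<close> and \<open>z\<close> enter different slots cancel in the
  supercommutator; those that enter the same slot are covered by \<open>slot_lsym\<close>.\<close>

lemma slotsum_lsym:
  assumes "slot_lsym (mpar par) G"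
  shows "slotsum (mpar par) z (slotsum (mpar par) y G) Y
           - sg (mpar par y \<and> mpar par z) (slotsum (mpar par) y (slotsum (mpar par) z G) Y) =
         slotsum (mpar par) (MNode y z) G Y
           - sg (mpar par y \<and> mpar par z) (slotsum (mpar par) (MNode z y) G Y)"
  using assms
proof (induction Y arbitrary: G)
  case (Cons x Y)
  let ?p = "mpar par"
  let ?G = "\<lambda>Y. G (x # Y)"
  have G: "slot_lsym ?p ?G"
    unfolding slot_lsym_def using Cons.prems unfolding slot_lsym_def
    by (metis append_Cons)
  have head: "G (MNode y (MNode z x) # Y) - sg (?p y \<and> ?p z) (G (MNode z (MNode y x) # Y)) =
     G (MNode (MNode y z) x # Y) - sg (?p y \<and> ?p z) (G (MNode (MNode z y) x # Y))"
    using Cons.prems unfolding slot_lsym_def by (metis append_Nil)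
  show ?case
    using head Cons.IH[OF G]
    by (cases "?p y"; cases "?p z"; cases "?p x")
      (simp_all add: slotsum_add slotsum_diff slotsum_uminus algebra_simps)
qed simp

text \<open>The operators of a GDN superalgebra: \<open>e t\<close> is the value of the tree \<open>t\<close>, \<open>L y\<close> is left
  multiplication by \<open>y\<close>, and \<open>\<rho> a f\<close> is \<open>f \<circ> a\<close> with the sign \<open>(-1)^(|a||f|)\<close>, so that \<open>\<rho> a\<close> acts like
  multiplication by \<open>D a\<close> from the left. Thus \<open>L_\<rho>\<close> reads \<open>y D\<^sup>2a = D (y D a) - D y D a\<close>; it is
  left-symmetry with \<open>f\<close> as one of the two symmetric arguments.\<close>

locale gdn_operators = vector_space scale
  for scale :: "'k::field \<Rightarrow> 'v::ab_group_add \<Rightarrow> 'v" +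
  fixes par :: "'x \<Rightarrow> bool"
    and e :: "'x mag \<Rightarrow> 'v"
    and L :: "'x mag \<Rightarrow> 'v \<Rightarrow> 'v"
    and \<rho> :: "'x mag \<Rightarrow> 'v \<Rightarrow> 'v"
  assumes L_add: "L y (f + g) = L y f + L y g"
    and L_scale: "L y (scale c f) = scale c (L y f)"
    and \<rho>_add: "\<rho> y (f + g) = \<rho> y f + \<rho> y g"
    and \<rho>_scale: "\<rho> y (scale c f) = scale c (\<rho> y f)"
    and L_e: "L y (e z) = e (MNode y z)"
    and \<rho>_e: "\<rho> a (e y) = sg (mpar par a \<and> mpar par y) (e (MNode y a))"
    and L_\<rho>: "L y (\<rho> a f) - sg (mpar par y \<and> mpar par a) (\<rho> a (L y f)) = \<rho> (MNode y a) f - \<rho> y (\<rho> a f)"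
    and \<rho>_\<rho>: "\<rho> a (\<rho> b f) = sg (mpar par a \<and> mpar par b) (\<rho> b (\<rho> a f))"
    and L_lsym: "L y (L z f) - L (MNode y z) f = sg (mpar par y \<and> mpar par z) (L z (L y f) - L (MNode z y) f)"
begin

abbreviation p :: "'x mag \<Rightarrow> bool" where "p \<equiv> mpar par"

section \<open>Linear maps and the superalgebra generated by right multiplications\<close>

definition lin :: "('v \<Rightarrow> 'v) \<Rightarrow> bool" where
  "lin T \<longleftrightarrow> (\<forall>f g. T (f + g) = T f + T g) \<and> (\<forall>c f. T (scale c f) = scale c (T f))"

lemma linI: "(\<And>f g. T (f + g) = T f + T g) \<Longrightarrow> (\<And>c f. T (scale c f) = scale c (T f)) \<Longrightarrow> lin T"
  by (simp add: lin_def)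

lemma lin_add: "lin T \<Longrightarrow> T (f + g) = T f + T g"
  and lin_scale: "lin T \<Longrightarrow> T (scale c f) = scale c (T f)"
  by (simp_all add: lin_def)

lemma lin_0: "lin T \<Longrightarrow> T 0 = 0"
  using lin_scale[of T 0 0] by simp

lemma lin_uminus: "lin T \<Longrightarrow> T (- f) = - T f"
  using lin_add[of T f "- f"] lin_0[of T] by (simp add: eq_neg_iff_add_eq_0 add.commute)

lemma lin_diff: "lin T \<Longrightarrow> T (f - g) = T f - T g"
  using lin_add[of T f "- g"] lin_uminus[of T g] by simp

lemma lin_sg: "lin T \<Longrightarrow> T (sg b f) = sg b (T f)"
  by (simp add: sg_def lin_uminus)

lemma lin_sum: "lin T \<Longrightarrow> T (sum h A) = (\<Sum>x\<in>A. T (h x))"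
  by (induction A rule: infinite_finite_induct) (simp_all add: lin_0 lin_add)

lemma lin_slotsum: "lin T \<Longrightarrow> T (slotsum q y G Y) = slotsum q y (\<lambda>Y. T (G Y)) Y"
  by (induction Y arbitrary: G) (simp_all add: lin_0 lin_add lin_sg)

lemma lin_L: "lin (L y)"
  by (rule linI) (rule L_add L_scale)+

lemma lin_\<rho>: "lin (\<rho> y)"
  by (rule linI) (rule \<rho>_add \<rho>_scale)+

lemma lin_sgn: "lin (sg b)"
  by (rule linI) (simp_all add: sg_def)

text \<open>The boolean is the parity. Signs are the only coefficients that occur, so negation takes
  the place of scalar multiplication.\<close>

inductive Rop :: "bool \<Rightarrow> ('v \<Rightarrow> 'v) \<Rightarrow> bool" where
  ident: "Rop False (\<lambda>f. f)"
| right: "Rop (p a) (\<rho> a)"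
| compose: "Rop q P \<Longrightarrow> Rop r Q \<Longrightarrow> Rop (q \<noteq> r) (\<lambda>f. P (Q f))"
| plus: "Rop q P \<Longrightarrow> Rop q Q \<Longrightarrow> Rop q (\<lambda>f. P f + Q f)"
| neg: "Rop q P \<Longrightarrow> Rop q (\<lambda>f. - P f)"
| null: "Rop q (\<lambda>f. 0)"

lemma Rop_minus: "Rop q P \<Longrightarrow> Rop q Q \<Longrightarrow> Rop q (\<lambda>f. P f - Q f)"
  using Rop.plus[OF _ Rop.neg, of q P Q] by simp

lemma Rop_sg: "Rop q P \<Longrightarrow> Rop q (\<lambda>f. sg b (P f))"
  by (cases b) (auto intro: Rop.neg)

lemma Rop_lin: "Rop q P \<Longrightarrow> lin P"
  by (induction rule: Rop.induct)
    (auto simp: lin_def \<rho>_add \<rho>_scale algebra_simps scale_right_distrib)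

lemma Rop_\<rho>_commute: "Rop q P \<Longrightarrow> P (\<rho> a f) = sg (p a \<and> q) (\<rho> a (P f))"
proof (induction arbitrary: f rule: Rop.induct)
  case (right b)
  then show ?case by (subst \<rho>_\<rho>) (rule sg_cong, auto)
next
  case (compose q P r Q)
  then show ?case
    by (simp add: lin_sg[OF Rop_lin]) (rule sg_cong, auto)
qed (auto simp: lin_0[OF lin_\<rho>] lin_add[OF lin_\<rho>] lin_uminus[OF lin_\<rho>] sg_add)

text \<open>The generators supercommute by \<open>\<rho>_\<rho>\<close>. One induction extends this
  to an operator against a generator, a second one to two operators.\<close>

lemma Rop_commute:
  assumes "Rop q P" "Rop r Q"
  shows "P (Q f) = sg (q \<and> r) (Q (P f))"
  using assms(1)
proof (induction arbitrary: f rule: Rop.induct)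
  case (right a)
  show ?case
    using Rop_\<rho>_commute[OF assms(2), of a f] by (subst sg_eq_flip)
next
  case (compose q P s P')
  then show ?case
    by (simp add: lin_sg[OF Rop_lin]) (rule sg_cong, auto)
qed (auto simp: Rop_lin[OF assms(2)] lin_0 lin_add lin_uminus sg_add)

text \<open>The supercommutator with \<open>L y\<close> is a superderivation, and
  \<open>L_\<rho>\<close> says that it keeps the generators inside the algebra. This is why brace
  operators supercommute although left multiplications occur in their definition.\<close>

lemma Rop_delta: "Rop q P \<Longrightarrow> Rop (p y \<noteq> q) (\<lambda>f. L y (P f) - sg (p y \<and> q) (P (L y f)))"
proof (induction rule: Rop.induct)
  case ident
  show ?case using Rop.null by simp
next
  case (right a)
  have "Rop (p (MNode y a)) (\<lambda>f. \<rho> (MNode y a) f - \<rho> y (\<rho> a f))"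
    using Rop_minus[OF Rop.right[of "MNode y a"]] Rop.compose[OF Rop.right[of y] Rop.right[of a]] by simp
  then show ?case by (simp add: L_\<rho>)
next
  case (compose q P r Q)
  \<comment> \<open>The Leibniz rule for the supercommutator: that of \<open>L y\<close> with
    \<open>P\<close>, followed by \<open>Q\<close>, plus the signed term in which \<open>Q\<close>
    is hit.\<close>
  let ?R = "\<lambda>f. (L y (P (Q f)) - sg (p y \<and> q) (P (L y (Q f)))) + sg (p y \<and> q) (P (L y (Q f) - sg (p y \<and> r) (Q (L y f))))"
  have "Rop ((p y \<noteq> q) \<noteq> r) (\<lambda>f. L y (P (Q f)) - sg (p y \<and> q) (P (L y (Q f))))"
    by (rule Rop.compose[OF compose.IH(1) compose.hyps(2)])
  moreover have "Rop (q \<noteq> (p y \<noteq> r)) (\<lambda>f. P (L y (Q f) - sg (p y \<and> r) (Q (L y f))))"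
    by (rule Rop.compose[OF compose.hyps(1) compose.IH(2)])
  moreover have "((p y \<noteq> q) \<noteq> r) = (p y \<noteq> (q \<noteq> r))" "(q \<noteq> (p y \<noteq> r)) = (p y \<noteq> (q \<noteq> r))" by auto
  ultimately have "Rop (p y \<noteq> (q \<noteq> r)) ?R"
    using Rop.plus[OF _ Rop_sg] by simp
  moreover have "?R = (\<lambda>f. L y (P (Q f)) - sg (p y \<and> (q \<noteq> r)) (P (Q (L y f))))"
    using lin_diff[OF Rop_lin[OF compose.hyps(1)]] lin_uminus[OF Rop_lin[OF compose.hyps(1)]]
      lin_add[OF Rop_lin[OF compose.hyps(1)]]
    by (cases "p y"; cases "q"; cases "r") simp_all
  ultimately show ?case by simp
next
  case (plus q P Q)
  show ?case
    using Rop.plus[OF plus.IH] by (simp add: L_add sg_add algebra_simps)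
next
  case (neg q P)
  show ?case
    using Rop.neg[OF neg.IH] by (simp add: lin_uminus[OF lin_L])
next
  case (null q)
  show ?case
    using Rop.null by (simp add: lin_0[OF lin_L])
qed

lemma Rop_slotsum:
  assumes "\<And>Y'. length Y' = length Y \<Longrightarrow> lpar p Y' = (lpar p Y \<noteq> p y) \<Longrightarrow> Rop q (T Y')"
  shows "Rop q (\<lambda>f. slotsum p y (\<lambda>Y. T Y f) Y)"
  using assms
proof (induction Y arbitrary: T)
  case Nil
  show ?case by (simp add: Rop.null)
next
  case (Cons z Y)
  have "Rop q (T (MNode y z # Y))"
    by (rule Cons.prems) auto
  moreover have "Rop q (\<lambda>f. slotsum p y (\<lambda>Y. T (z # Y) f) Y)"
    by (rule Cons.IH, rule Cons.prems) auto
  ultimately show ?case by (simp add: Rop.plus Rop_sg)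
qed

subsection \<open>Symmetric braces\<close>

text \<open>One step of the Oudom-Guin recursion. The value \<open>0\<close> on the empty list makes
  braces vanish on lists that are too short.\<close>

primrec dop :: "('x mag list \<Rightarrow> 'v) \<Rightarrow> 'x mag list \<Rightarrow> 'v" where
  "dop G [] = 0"
| "dop G (y # Y) = L y (G Y) - slotsum p y G Y"

text \<open>\<open>brace a n [y\<^sub>1, \<dots>, y\<^sub>n]\<close> stands for \<open>y\<^sub>1 \<cdots> y\<^sub>n D\<^sup>na\<close>, and \<open>brace_op a n [y\<^sub>1, \<dots>, y\<^sub>n]\<close> for
  multiplication by \<open>y\<^sub>1 \<cdots> y\<^sub>n D\<^sup>n\<^sup>+\<^sup>1a\<close>; the recursion is the Leibniz rule for the vector field \<open>y D\<close>.
  Both vanish on lists of the wrong length.\<close>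

primrec brace :: "'x mag \<Rightarrow> nat \<Rightarrow> 'x mag list \<Rightarrow> 'v" where
  "brace a 0 = (\<lambda>Y. if Y = [] then e a else 0)"
| "brace a (Suc n) = dop (brace a n)"

primrec brace_op :: "'x mag \<Rightarrow> nat \<Rightarrow> 'x mag list \<Rightarrow> 'v \<Rightarrow> 'v" where
  "brace_op a 0 = (\<lambda>u f. if u = [] then \<rho> a f else 0)"
| "brace_op a (Suc n) = (\<lambda>u f. case u of [] \<Rightarrow> 0 | y # u \<Rightarrow>
     L y (brace_op a n u f) - sg (p y \<and> (lpar p u \<noteq> p a)) (brace_op a n u (L y f))
       - slotsum p y (\<lambda>u. brace_op a n u f) u)"

lemma slotsum_eq_0:
  "(\<And>Y'. length Y' = length Y \<Longrightarrow> G Y' = 0) \<Longrightarrow> slotsum p y G Y = 0"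
  using slotsum_cong[of Y par y G "\<lambda>_. 0"] by simp

lemma brace_length: "length Y \<noteq> n \<Longrightarrow> brace a n Y = 0"
proof (induction n arbitrary: Y)
  case (Suc n)
  then show ?case
    by (cases Y) (auto simp: lin_0[OF lin_L] intro!: slotsum_eq_0)
qed simp

text \<open>Each recursion step is a supercommutator with \<open>L y\<close>, which
  \<open>Rop_delta\<close> keeps in the algebra, minus a slot sum of operators already
  there.\<close>

lemma Rop_brace_op: "Rop (lpar p u \<noteq> p a) (brace_op a n u)"
proof (induction n arbitrary: u)
  case 0
  show ?case using Rop.right[of a] Rop.null by (cases u) simp_all
next
  case (Suc n)
  show ?case
  proof (cases u)
    case Nil
    then show ?thesis using Rop.null by simp
  next
    case (Cons y v)
    have "Rop (p y \<noteq> (lpar p v \<noteq> p a)) (\<lambda>f. slotsum p y (\<lambda>u. brace_op a n u f) v)"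
    proof (rule Rop_slotsum)
      fix Y' :: "'x mag list"
      assume "lpar p Y' = (lpar p v \<noteq> p y)"
      then have "(p y \<noteq> (lpar p v \<noteq> p a)) = (lpar p Y' \<noteq> p a)" by auto
      then show "Rop (p y \<noteq> (lpar p v \<noteq> p a)) (brace_op a n Y')"
        using Suc.IH[of Y'] by simp
    qed
    from Rop_minus[OF Rop_delta[OF Suc.IH] this]
    have "Rop (p y \<noteq> (lpar p v \<noteq> p a)) (brace_op a (Suc n) u)"
      using Cons by simp
    moreover have "(p y \<noteq> (lpar p v \<noteq> p a)) = (lpar p u \<noteq> p a)"
      using Cons by auto
    ultimately show ?thesis by simp
  qed
qed

text \<open>In the slot sum of the brace the last slot stands apart: it contributes the operator
  applied to \<open>w \<circ> y\<close>, and this turns the left multiplication by \<open>w\<close>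
  into the supercommutator that defines \<open>brace_op\<close>.\<close>

lemma brace_snoc: "brace a (Suc n) (u @ [y]) = sg (p a \<and> p y) (brace_op a n u (e y))"
proof (induction n arbitrary: u y)
  case 0
  show ?case
  proof (cases u)
    case Nil
    then show ?thesis by (simp add: L_e \<rho>_e)
  next
    case (Cons w v)
    then show ?thesis using brace_length[of "u @ [y]" "Suc 0" a] by simp
  qed
next
  case (Suc n)
  show ?case
  proof (cases u)
    case Nil
    then show ?thesis using brace_length[of "u @ [y]" "Suc (Suc n)" a] by simp
  next
    case (Cons w v)
    have 1: "slotsum p w (brace a (Suc n)) (v @ [y]) =
        sg (p a \<and> p y) (slotsum p w (\<lambda>u. brace_op a n u (e y)) v) +
        sg (p w \<and> lpar p v) (sg (p a \<and> (p w \<noteq> p y)) (brace_op a n v (e (MNode w y))))"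
      using Suc.IH[of v "MNode w y"]
      by (simp add: slotsum_append[of _ _ _ v] Suc.IH slotsum_sg del: brace.simps)
    have "brace a (Suc (Suc n)) (u @ [y]) = L w (brace a (Suc n) (v @ [y])) - slotsum p w (brace a (Suc n)) (v @ [y])"
      using Cons by simp
    also have "\<dots> = sg (p a \<and> p y) (L w (brace_op a n v (e y)))
        - (sg (p a \<and> p y) (slotsum p w (\<lambda>u. brace_op a n u (e y)) v) +
        sg (p w \<and> lpar p v) (sg (p a \<and> (p w \<noteq> p y)) (brace_op a n v (L w (e y)))))"
      unfolding 1 Suc.IH lin_sg[OF lin_L] L_e ..
    also have "\<dots> = sg (p a \<and> p y) (brace_op a (Suc n) u (e y))"
      using Cons by (cases "p a"; cases "p y"; cases "p w"; cases "lpar p v") simp_all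
    finally show ?thesis .
  qed
qed

text \<open>Supersymmetry carries any slot to the end, where \<open>G\<close> depends linearly on
  the value of the tree, up to sign; there \<open>L_lsym\<close> applies.\<close>

lemma slot_lsymI:
  assumes sym: "supersym p G"
    and snoc: "\<And>v. \<exists>T q. lin T \<and> (\<forall>y. G (v @ [y]) = sg (p y \<and> q) (T (e y)))"
  shows "slot_lsym p G"
  unfolding slot_lsym_def
proof (intro allI)
  fix u x v y z
  obtain T q where T: "lin T" "\<And>y. G ((u @ v) @ [y]) = sg (p y \<and> q) (T (e y))"
    using snoc[of "u @ v"] by blast
  have G: "G (u @ t # v) = sg (p t \<and> (lpar p v \<noteq> q)) (T (e t))" for t
    using supersym_move[OF sym, of u t v "[]"] T(2)[of t] by (simp, intro sg_cong) auto
  have "T (e (MNode y (MNode z x))) - T (e (MNode (MNode y z) x)) =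
      sg (p y \<and> p z) (T (e (MNode z (MNode y x))) - T (e (MNode (MNode z y) x)))"
    using arg_cong[OF L_lsym[of y z "e x"], of T]
    by (simp add: L_e lin_sg[OF T(1)] lin_diff[OF T(1)])
  then show "G (u @ MNode y (MNode z x) # v) - sg (p y \<and> p z) (G (u @ MNode z (MNode y x) # v)) =
     G (u @ MNode (MNode y z) x # v) - sg (p y \<and> p z) (G (u @ MNode (MNode z y) x # v))"
    unfolding G
    by (cases "p y"; cases "p z"; cases "p x"; cases "lpar p v"; cases q) (simp_all add: algebra_simps)
qed

text \<open>Swaps beyond the first letter are inherited from \<open>dop G\<close>. For the first two
  letters both sides expand into double left multiplications and double slot sums, which
  \<open>L_lsym\<close> and \<open>slotsum_lsym\<close> exchange.\<close>

lemma supersym_dop_dop: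
  assumes sym: "supersym p (dop G)" and lsym: "slot_lsym p G"
  shows "supersym p (dop (dop G))"
  unfolding supersym_def
proof (intro allI)
  fix u y z v
  show "dop (dop G) (u @ y # z # v) = sg (p y \<and> p z) (dop (dop G) (u @ z # y # v))"
  proof (cases u)
    case Nil
    have 1: "slotsum p y (slotsum p z G) v
           - sg (p z \<and> p y) (slotsum p z (slotsum p y G) v) =
         slotsum p (MNode z y) G v
           - sg (p z \<and> p y) (slotsum p (MNode y z) G v)"
      by (rule slotsum_lsym[OF lsym])
    have 2: "dop (dop G) (y # z # v) =
       L y (L z (G v)) - L (MNode y z) (G v) - L y (slotsum p z G v) + slotsum p (MNode y z) G v
         - sg (p y \<and> p z) (L z (slotsum p y G v) - slotsum p y (slotsum p z G) v)" for y z
      by (simp add: lin_diff[OF lin_L] slotsum_diff lin_slotsum[OF lin_L, symmetric] sg_diff)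
    show ?thesis
      using Nil 1 L_lsym[of y z "G v"] unfolding 2
      by (simp only: append_Nil 2) (cases "p y"; cases "p z"; simp add: algebra_simps)
  next
    case (Cons w u')
    then show ?thesis
      using supersymD[OF sym, of u' y z v] supersymD[OF supersym_slotsum[OF sym], of w u' y z v]
      by (simp add: lin_sg[OF lin_L] sg_diff)
  qed
qed

lemma supersym_brace: "supersym p (brace a n)"
proof -
  \<comment> \<open>A swap needs two letters, and these braces vanish on lists of length two or
    more.\<close>
  have short: "supersym p (brace a m)" if "m \<le> 1" for m
    unfolding supersym_def using that by (simp add: brace_length)
  \<comment> \<open>Two consecutive braces are carried along, because
    \<open>supersym_dop_dop\<close> uses both \<open>G\<close> and \<open>dop G\<close>.\<close>
  have "supersym p (brace a n) \<and> supersym p (brace a (Suc n))"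
  proof (induction n)
    case 0
    show ?case using short[of 0] short[of 1] by simp
  next
    case (Suc n)
    have "slot_lsym p (brace a n)"
    proof (rule slot_lsymI)
      show "supersym p (brace a n)" using Suc.IH ..
      fix v
      show "\<exists>T q. lin T \<and> (\<forall>y. brace a n (v @ [y]) = sg (p y \<and> q) (T (e y)))"
      proof (cases n)
        case 0
        then show ?thesis by (intro exI[of _ "\<lambda>f. 0"]) (simp add: lin_def)
      next
        case (Suc m)
        show ?thesis unfolding Suc
          by (intro exI[of _ "brace_op a m v"] exI[of _ "p a"])
            (auto simp: brace_snoc conj_commute simp del: brace.simps intro!: Rop_lin Rop_brace_op)
      qed
    qed
    then show ?case using Suc.IH supersym_dop_dop[of "brace a n"] by simp
  qed
  then show ?thesis ..
qed

section \<open>Products of brace operators\<close>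

abbreviation opar :: "('x mag \<times> nat) list \<Rightarrow> bool" where
  "opar \<equiv> lpar (\<lambda>c. p (fst c))"

text \<open>A pair \<open>(a, n)\<close> in \<open>as\<close> stands for the letter \<open>D\<^sup>n\<^sup>+\<^sup>1a\<close>, and \<open>comb as ys\<close> for the product of \<open>ys\<close> with
  these letters. It is \<open>0\<close> unless the product has weight \<open>-1\<close>, since \<open>brace_op\<close> fixes the length of its
  argument.\<close>

primrec comb :: "('x mag \<times> nat) list \<Rightarrow> 'x mag list \<Rightarrow> 'v" where
  "comb [] = (\<lambda>ys. case ys of [z] \<Rightarrow> e z | _ \<Rightarrow> 0)"
| "comb (c # as) = (\<lambda>ys. sg (p (fst c) \<and> lpar p (drop (snd c) ys))
     (brace_op (fst c) (snd c) (take (snd c) ys) (comb as (drop (snd c) ys))))"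

lemma lin_brace_op: "lin (brace_op a n u)"
  by (rule Rop_lin[OF Rop_brace_op])

lemma comb_Nil [simp]: "comb as [] = 0"
  by (induction as) (simp_all add: lin_0[OF lin_brace_op])

lemma comb_length: "length ys \<noteq> Suc (sum_list (map snd as)) \<Longrightarrow> comb as ys = 0"
proof (induction as arbitrary: ys)
  case Nil
  then show ?case by (auto split: list.split)
next
  case (Cons c as)
  show ?case
  proof (cases "length ys < snd c")
    case True
    then show ?thesis by (simp add: lin_0[OF lin_brace_op])
  next
    case False
    then show ?thesis
      using Cons by (simp add: lin_0[OF lin_brace_op])
  qed
qed

lemma comb_append:
  assumes "length u = n"
  shows "comb ((a, n) # as) (u @ v) = sg (p a \<and> lpar p v) (brace_op a n u (comb as v))"
  using assms by simp

text \<open>Unfolding \<open>comb\<close> leaves the last underived letter as the operand of a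
  product of brace operators. Later proofs rely on this product lying in the supercommutative
  algebra.\<close>

lemma comb_snoc:
  "\<exists>Q. Rop (lpar p v \<noteq> opar as) Q \<and> (\<forall>z. comb as (v @ [z]) = sg (p z \<and> opar as) (Q (e z)))"
proof (induction as arbitrary: v)
  case Nil
  show ?case
  proof (cases v)
    case Nil
    then show ?thesis using Rop.ident by (intro exI[of _ "\<lambda>f. f"]) simp
  next
    case (Cons y u)
    then show ?thesis using Rop.null by (intro exI[of _ "\<lambda>f. 0"]) (auto split: list.split)
  qed
next
  case (Cons c as)
  obtain a n where c: "c = (a, n)" by (cases c)
  show ?case
  proof (cases "length v < n")
    case True
    then have "drop n (v @ [z]) = []" for z by simp
    then have "comb (c # as) (v @ [z]) = 0" for z
      using c by (simp add: lin_0[OF lin_brace_op])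
    then show ?thesis using Rop.null by (intro exI[of _ "\<lambda>f. 0"]) simp
  next
    case False
    define u w where "u = take n v" and "w = drop n v"
    then have v: "v = u @ w" and u: "length u = n" using False by simp_all
    obtain Q where Q: "Rop (lpar p w \<noteq> opar as) Q"
      "\<And>z. comb as (w @ [z]) = sg (p z \<and> opar as) (Q (e z))"
      using Cons.IH[of w] by blast
    have A: "Rop ((lpar p u \<noteq> p a) \<noteq> (lpar p w \<noteq> opar as)) (\<lambda>f. sg (p a \<and> lpar p w) (brace_op a n u (Q f)))"
      by (rule Rop_sg[OF Rop.compose[OF Rop_brace_op Q(1)]])
    have B: "((lpar p u \<noteq> p a) \<noteq> (lpar p w \<noteq> opar as)) = (lpar p v \<noteq> opar (c # as))"
      unfolding v c by auto
    have "comb (c # as) (v @ [z]) =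
        sg (p z \<and> opar (c # as)) (sg (p a \<and> lpar p w) (brace_op a n u (Q (e z))))" for z
      unfolding c v append_assoc comb_append[OF u] Q(2) lin_sg[OF lin_brace_op] sg_simps
      by (rule sg_cong) auto
    then show ?thesis using A[unfolded B] by blast
  qed
qed

text \<open>The swap lies inside the first block of \<open>n\<close> letters, beyond it, or across
  its end. Across the end, the letter after the block is made the operand, and the block together
  with it forms a full brace, which is symmetric.\<close>

lemma supersym_comb: "supersym p (comb as)"
proof (induction as)
  case Nil
  show ?case unfolding supersym_def by (auto split: list.split simp: Cons_eq_append_conv append_eq_Cons_conv)
next
  case (Cons c as)
  obtain a n where c: "c = (a, n)" by (cases c)
  \<comment> \<open>The operand is \<open>Q\<close> applied to the value of a tree. Commuting
    \<open>Q\<close> out completes the operator to a brace with one more argument, whose symmetry is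
    known.\<close>
  have brace_op_sym: "brace_op a n u (comb as v) = sg (p y \<and> p z) (brace_op a n u' (comb as v))"
    if u: "u = u1 @ y # z # u2" "u' = u1 @ z # y # u2" for u u' u1 u2 y z v
  proof (cases v rule: rev_cases)
    case Nil
    then show ?thesis by (simp add: lin_0[OF lin_brace_op])
  next
    case (snoc w x)
    obtain Q where Q: "Rop (lpar p w \<noteq> opar as) Q" "\<And>z. comb as (w @ [z]) = sg (p z \<and> opar as) (Q (e z))"
      using comb_snoc[of w as] by blast
    have *: "brace_op a n u (e x) = sg (p y \<and> p z) (brace_op a n u' (e x))"
      using supersymD[OF supersym_brace, of a "Suc n" u1 y z "u2 @ [x]"]
        brace_snoc[of a n u x] brace_snoc[of a n u' x] u
      by (cases "p a"; cases "p x"; simp del: brace.simps)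
    have "lpar p u = lpar p u'" using u by auto
    then show ?thesis
      unfolding snoc Q(2) lin_sg[OF lin_brace_op]
      by (simp add: Rop_commute[OF Rop_brace_op Q(1), of a n] * lin_sg[OF Rop_lin[OF Q(1)]])
         (rule sg_cong, auto)
  qed
  have move: "comb as (z # v) = sg (p z \<and> lpar p v) (comb as (v @ [z]))" for z v
    using supersym_move[OF Cons.IH, of "[]" z v "[]"] by simp
  show ?case unfolding supersym_def
  proof (intro allI)
    fix u y z v
    show "comb (c # as) (u @ y # z # v) = sg (p y \<and> p z) (comb (c # as) (u @ z # y # v))"
    proof -
      consider (left) "length u + 2 \<le> n" | (mid) "n = length u + 1" | (right) "n \<le> length u" by linarith
      then show ?thesis
      proof cases
        case left
        define v1 v2 where "v1 = take (n - length u - 2) v" and "v2 = drop (n - length u - 2) v"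
        then have v: "v = v1 @ v2" by simp
        have t: "take n (u @ s # t # v) = u @ s # t # v1" "drop n (u @ s # t # v) = v2" for s t
          using left by (simp_all add: v1_def v2_def take_Cons' drop_Cons')
        show ?thesis
          unfolding c comb.simps fst_conv snd_conv t
          by (simp add: brace_op_sym[OF refl refl, of u y z v1 v2]) (rule sg_cong, auto)
      next
        case mid
        obtain Q where Q: "Rop (lpar p v \<noteq> opar as) Q" "\<And>z. comb as (v @ [z]) = sg (p z \<and> opar as) (Q (e z))"
          using comb_snoc[of v as] by blast
        \<comment> \<open>Here \<open>s\<close> ends the block and \<open>t\<close> follows it:
          \<open>t\<close> is moved to the end of the list, and \<open>Q\<close> is then commuted
          past \<open>brace_op\<close>.\<close>
        have *: "comb (c # as) (u @ s # t # v) =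
             sg (p a \<and> (p t \<noteq> lpar p v)) (sg (p t \<and> lpar p v) (sg (p t \<and> opar as)
               (sg ((lpar p u \<noteq> (p s \<noteq> p a)) \<and> (lpar p v \<noteq> opar as)) (sg (p a \<and> p t) (Q (brace a (Suc n) (u @ [s, t])))))))" for s t
        proof -
          have "comb (c # as) ((u @ [s]) @ t # v) =
             sg (p a \<and> (p t \<noteq> lpar p v)) (sg (p t \<and> lpar p v) (sg (p t \<and> opar as) (brace_op a n (u @ [s]) (Q (e t)))))"
            unfolding c using mid by (subst comb_append) (simp_all add: move Q(2) lin_sg[OF lin_brace_op] del: brace_op.simps)
          moreover have "brace_op a n (u @ [s]) (e t) = sg (p a \<and> p t) (brace a (Suc n) (u @ [s, t]))"
            using brace_snoc[of a n "u @ [s]" t] by (subst sg_eq_flip) simp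
          moreover have "brace_op a n (u @ [s]) (Q (e t)) =
             sg ((lpar p u \<noteq> (p s \<noteq> p a)) \<and> (lpar p v \<noteq> opar as)) (Q (brace_op a n (u @ [s]) (e t)))"
            by (subst Rop_commute[OF Rop_brace_op Q(1)]) (rule sg_cong, auto)
          ultimately show ?thesis by (simp add: lin_sg[OF Rop_lin[OF Q(1)]])
        qed
        have "brace a (Suc n) (u @ [y, z]) = sg (p y \<and> p z) (brace a (Suc n) (u @ [z, y]))"
          using supersymD[OF supersym_brace, of a "Suc n" u y z "[]"] by simp
        then show ?thesis
          unfolding * by (simp add: lin_sg[OF Rop_lin[OF Q(1)]] del: brace.simps) (rule sg_cong, auto)
      next
        case right
        define u1 u2 where "u1 = take n u" and "u2 = drop n u"
        then have u: "u = u1 @ u2" and l: "length u1 = n" using right by simp_all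
        show ?thesis
          unfolding c u append_assoc comb_append[OF l] supersymD[OF Cons.IH, of u2 y z v]
          by (simp add: lin_sg[OF lin_brace_op]) (rule sg_cong, auto)
      qed
    qed
  qed
qed

text \<open>Exchanging two derived letters is the supercommutation of their brace operators, once
  supersymmetry has exchanged their blocks of arguments.\<close>

lemma comb_swap: "comb (bs @ c # d # as) ys = sg (p (fst c) \<and> p (fst d)) (comb (bs @ d # c # as) ys)"
proof (induction bs arbitrary: ys)
  case Nil
  obtain a n b m where cd: "c = (a, n)" "d = (b, m)" by (cases c, cases d)
  show ?case
  proof (cases "length ys < n + m")
    case True
    then show ?thesis using cd by (simp add: comb_length del: comb.simps)
  next
    case False
    define u v w where "u = take n ys" and "v = take m (drop n ys)" and "w = drop m (drop n ys)"
    then have ys: "ys = u @ v @ w" and l: "length u = n" "length v = m"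
      using False by (simp_all del: drop_drop)
    have "comb (d # c # as) (u @ v @ w) = sg (lpar p u \<and> lpar p v) (comb (d # c # as) (v @ u @ w))"
      by (rule supersym_swap[OF supersym_comb])
    also have "comb (d # c # as) (v @ u @ w) = sg (p b \<and> (lpar p u \<noteq> lpar p w)) (sg (p a \<and> lpar p w)
        (brace_op b m v (brace_op a n u (comb as w))))"
      unfolding cd comb_append[OF l(2)] comb_append[OF l(1)] by (simp add: lin_sg[OF lin_brace_op])
    finally have 1: "comb (d # c # as) ys = sg (lpar p u \<and> lpar p v) (sg (p b \<and> (lpar p u \<noteq> lpar p w)) (sg (p a \<and> lpar p w)
        (brace_op b m v (brace_op a n u (comb as w)))))"
      unfolding ys .
    have 2: "comb (c # d # as) ys = sg (p a \<and> (lpar p v \<noteq> lpar p w)) (sg (p b \<and> lpar p w)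
        (brace_op a n u (brace_op b m v (comb as w))))"
      unfolding ys cd comb_append[OF l(2)] comb_append[OF l(1)] by (simp add: lin_sg[OF lin_brace_op])
    have 3: "brace_op a n u (brace_op b m v (comb as w)) =
        sg ((lpar p u \<noteq> p a) \<and> (lpar p v \<noteq> p b)) (brace_op b m v (brace_op a n u (comb as w)))"
      by (rule Rop_commute[OF Rop_brace_op Rop_brace_op])
    show ?thesis
      unfolding append_Nil 1 2 3 unfolding cd fst_conv sg_simps by (rule sg_cong) auto
  qed
next
  case (Cons b bs)
  then show ?case
    by (simp add: lin_sg[OF lin_brace_op]) (rule sg_cong, auto)
qed

text \<open>The derivation on derived letters; it carries no signs since \<open>D\<close> is
  even.\<close>

primrec dlast :: "(('x mag \<times> nat) list \<Rightarrow> 'v) \<Rightarrow> ('x mag \<times> nat) list \<Rightarrow> 'v" where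
  "dlast H [] = 0"
| "dlast H (c # as) = H ((fst c, Suc (snd c)) # as) + dlast (\<lambda>as. H (c # as)) as"

lemma dlast_lin: "lin T \<Longrightarrow> T (dlast H as) = dlast (\<lambda>as. T (H as)) as"
  by (induction as arbitrary: H) (simp_all add: lin_0 lin_add)

lemma dlast_zero: "(\<And>as'. sum_list (map snd as') = Suc (sum_list (map snd as)) \<Longrightarrow> H as' = 0) \<Longrightarrow> dlast H as = 0"
proof (induction as arbitrary: H)
  case (Cons c as)
  have "H ((fst c, Suc (snd c)) # as) = 0" by (rule Cons.prems) simp
  moreover have "dlast (\<lambda>as. H (c # as)) as = 0"
    by (rule Cons.IH, rule Cons.prems) simp
  ultimately show ?case by simp
qed simp

text \<open>This is the Leibniz rule for \<open>y D\<close> on a product: an underived factor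
  absorbs \<open>y\<close>, whereas a derived factor is raised by one order and \<open>y\<close>
  stays behind as a new underived letter. The recursion of \<open>brace_op\<close> supplies the term
  of the first derived letter, the induction hypothesis the others.\<close>

lemma L_comb: "L y (comb as ys) = slotsum p y (comb as) ys + dlast (\<lambda>as. comb as (y # ys)) as"
proof (induction as arbitrary: ys)
  case Nil
  show ?case
    by (auto simp: L_e lin_0[OF lin_L] split: list.split)
next
  case (Cons c as)
  obtain a n where c: "c = (a, n)" by (cases c)
  show ?case
  proof (cases "length ys = Suc (sum_list (map snd (c # as)))")
    case False
    then have 1: "comb (c # as) ys = 0" by (rule comb_length)
    have 2: "slotsum p y (comb (c # as)) ys = 0"
      by (rule slotsum_eq_0, rule comb_length) (use False in simp)
    have 3: "dlast (\<lambda>as. comb as (y # ys)) (c # as) = 0"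
      by (rule dlast_zero, rule comb_length) (use False in simp)
    show ?thesis unfolding 1 2 3 by (simp add: lin_0[OF lin_L])
  next
    case True
    define u v where "u = take n ys" and "v = drop n ys"
    then have ys: "ys = u @ v" and l: "length u = n" using True c by simp_all
    define g where "g = comb as v"
    have 1: "L y (comb (c # as) ys) = sg (p a \<and> lpar p v) (L y (brace_op a n u g))"
      unfolding ys c comb_append[OF l] g_def by (simp add: lin_sg[OF lin_L])
    have 2: "slotsum p y (\<lambda>u. comb (c # as) (u @ v)) u = sg (p a \<and> lpar p v) (slotsum p y (\<lambda>u. brace_op a n u g) u)"
      unfolding slotsum_sg[symmetric] c g_def using l by (intro slotsum_cong) simp
    have 3: "slotsum p y (\<lambda>v. comb (c # as) (u @ v)) v =
        sg (p a \<and> (lpar p v \<noteq> p y)) (brace_op a n u (slotsum p y (comb as) v))"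
      unfolding lin_slotsum[OF lin_brace_op] slotsum_sg[symmetric] c
      using l by (intro slotsum_cong) simp
    have 4: "comb ((a, Suc n) # as) (y # ys) = sg (p a \<and> lpar p v)
       (L y (brace_op a n u g) - sg (p y \<and> (lpar p u \<noteq> p a)) (brace_op a n u (L y g))
          - slotsum p y (\<lambda>u. brace_op a n u g) u)"
      using comb_append[of "y # u" "Suc n" a as v] l unfolding ys g_def by simp
    \<comment> \<open>The new letter \<open>y\<close> stands in front of the block \<open>u\<close>;
      it is taken past the block so that the first operator still receives its \<open>n\<close>
      arguments.\<close>
    have move: "comb ((a, n) # as') (y # ys) = sg (p y \<and> lpar p u)
        (sg (p a \<and> (lpar p v \<noteq> p y)) (brace_op a n u (comb as' (y # v))))" for as'
      using supersym_move[OF supersym_comb, of "(a, n) # as'" "[]" y u v] comb_append[OF l, of a as' "y # v"]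
      unfolding ys by (simp add: l del: comb.simps) (rule sg_cong, auto)
    have 5: "dlast (\<lambda>as. comb as (y # ys)) (c # as) = comb ((a, Suc n) # as) (y # ys) +
       sg (p y \<and> lpar p u) (sg (p a \<and> (lpar p v \<noteq> p y)) (brace_op a n u (dlast (\<lambda>as. comb as (y # v)) as)))"
      unfolding dlast.simps c fst_conv snd_conv move
      by (simp only: dlast_lin[OF lin_brace_op] dlast_lin[OF lin_sgn])
    have 6: "dlast (\<lambda>as. comb as (y # v)) as = L y g - slotsum p y (comb as) v"
      unfolding g_def Cons.IH by simp
    show ?thesis
      unfolding 1 5 4 6 unfolding ys slotsum_append[of _ _ _ u] 2 3
      by (cases "p y"; cases "p a"; cases "lpar p u"; cases "lpar p v")
        (simp_all add: lin_diff[OF lin_brace_op] lin_uminus[OF lin_brace_op])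
  qed
qed

subsection \<open>The symmetric functional on differential words\<close>

abbreviation q :: "'x mag \<times> nat \<Rightarrow> bool" where "q \<equiv> (\<lambda>c. p (fst c))"

text \<open>In a word, \<open>(t, k)\<close> stands for \<open>D\<^sup>kt\<close>. The operator \<open>dw\<close> precomposes a functional on words with the
  derivation.\<close>

definition wt :: "('x mag \<times> nat) list \<Rightarrow> int" where
  "wt w = (\<Sum>c\<leftarrow>w. int (snd c) - 1)"

lemma wt_simps [simp]: "wt [] = 0" "wt (c # w) = int (snd c) - 1 + wt w" "wt (u @ v) = wt u + wt v"
  by (simp_all add: wt_def)

definition supp :: "int \<Rightarrow> (('x mag \<times> nat) list \<Rightarrow> 'v) \<Rightarrow> bool" where
  "supp m H \<longleftrightarrow> (\<forall>w. wt w \<noteq> m \<longrightarrow> H w = 0)"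

primrec dw :: "(('x mag \<times> nat) list \<Rightarrow> 'v) \<Rightarrow> ('x mag \<times> nat) list \<Rightarrow> 'v" where
  "dw H [] = 0"
| "dw H (c # w) = H ((fst c, Suc (snd c)) # w) + dw (\<lambda>w. H (c # w)) w"

lemma dw_lin: "lin T \<Longrightarrow> dw (\<lambda>w. T (H w)) w = T (dw H w)"
  by (induction w arbitrary: H) (simp_all add: lin_0 lin_add)

lemma dw_zero [simp]: "dw (\<lambda>w. 0) w = 0"
  by (induction w) simp_all

lemma dw_add: "dw (\<lambda>w. H w + G w) w = dw H w + dw G w"
  by (induction w arbitrary: H G) (simp_all add: algebra_simps)

lemma add_diff_swap: "f + g - (h + k) = (f - h) + (g - k)" for f g h k :: 'v
  by (simp add: algebra_simps)

lemma lin_minus: "lin uminus"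
  by (rule linI) simp_all

lemma dw_append: "dw H (u @ v) = dw (\<lambda>u. H (u @ v)) u + dw (\<lambda>v. H (u @ v)) v"
  by (induction u arbitrary: H) (simp_all add: add.assoc)

lemma supersym_dw:
  assumes H: "supersym q H"
  shows "supersym q (dw H)"
  unfolding supersym_def
proof (intro allI)
  fix u y z v
  have 1: "dw (\<lambda>u. H (u @ y # z # v)) u = sg (q y \<and> q z) (dw (\<lambda>u. H (u @ z # y # v)) u)"
    by (simp add: supersymD[OF H, of _ y z v] dw_lin[OF lin_sgn])
  have 2: "dw (\<lambda>v. H (u @ y # z # v)) v = sg (q y \<and> q z) (dw (\<lambda>v. H (u @ z # y # v)) v)"
    by (simp add: supersymD[OF H, of u y z] dw_lin[OF lin_sgn])
  have 3: "H (u @ (fst y, Suc (snd y)) # z # v) = sg (q y \<and> q z) (H (u @ z # (fst y, Suc (snd y)) # v))"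
    using supersymD[OF H, of u "(fst y, Suc (snd y))" z v] by simp
  have 4: "H (u @ y # (fst z, Suc (snd z)) # v) = sg (q y \<and> q z) (H (u @ (fst z, Suc (snd z)) # y # v))"
    using supersymD[OF H, of u y "(fst z, Suc (snd z))" v] by simp
  show "dw H (u @ y # z # v) = sg (q y \<and> q z) (dw H (u @ z # y # v))"
    unfolding dw_append[of H u] dw.simps 1 2 3 4
    by (simp add: sg_add algebra_simps)
qed

lemma supp_dw:
  assumes "supp m H"
  shows "supp (m - 1) (dw H)"
proof -
  have "dw H w = 0" if "\<And>w'. wt w' = wt w + 1 \<Longrightarrow> H w' = 0" for H w
    using that
  proof (induction w arbitrary: H)
    case (Cons c w)
    have "H ((fst c, Suc (snd c)) # w) = 0" by (rule Cons.prems) simp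
    moreover have "dw (\<lambda>w. H (c # w)) w = 0" by (rule Cons.IH, rule Cons.prems) simp
    ultimately show ?case by simp
  qed simp
  then show ?thesis using assms unfolding supp_def by force
qed

text \<open>Sorting a word: \<open>ysw\<close> and \<open>asw\<close> extract its underived and
  derived letters, and \<open>sgw\<close> is the sign of moving the former to the left of the
  latter. A letter \<open>(t, Suc n)\<close> is recorded as \<open>(t, n)\<close>, the convention of
  \<open>comb\<close>.\<close>

primrec ysw :: "('x mag \<times> nat) list \<Rightarrow> 'x mag list" where
  "ysw [] = []"
| "ysw (c # w) = (case snd c of 0 \<Rightarrow> fst c # ysw w | Suc n \<Rightarrow> ysw w)"

primrec asw :: "('x mag \<times> nat) list \<Rightarrow> ('x mag \<times> nat) list" where
  "asw [] = []"
| "asw (c # w) = (case snd c of 0 \<Rightarrow> asw w | Suc n \<Rightarrow> (fst c, n) # asw w)"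

primrec sgw :: "('x mag \<times> nat) list \<Rightarrow> bool" where
  "sgw [] = False"
| "sgw (c # w) = (case snd c of 0 \<Rightarrow> sgw w | Suc n \<Rightarrow> (q c \<and> lpar p (ysw w)) \<noteq> sgw w)"

text \<open>\<open>G\<close> is kept general so that inductions along a word can absorb the leading
  letter into it.\<close>

definition wfun :: "(('x mag \<times> nat) list \<Rightarrow> 'x mag list \<Rightarrow> 'v) \<Rightarrow> ('x mag \<times> nat) list \<Rightarrow> 'v" where
  "wfun G w = sg (sgw w) (G (asw w) (ysw w))"

definition \<Phi> :: "('x mag \<times> nat) list \<Rightarrow> 'v" where
  "\<Phi> = wfun comb"

lemma ysw_append [simp]: "ysw (u @ v) = ysw u @ ysw v"
  by (induction u) (simp_all split: nat.split)

lemma asw_append [simp]: "asw (u @ v) = asw u @ asw v"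
  by (induction u) (simp_all split: nat.split)

lemma sgw_append: "sgw (u @ v) = ((sgw u \<noteq> sgw v) \<noteq> (opar (asw u) \<and> lpar p (ysw v)))"
  by (induction u) (auto split: nat.split)

text \<open>Two underived letters are exchanged by \<open>supersym_comb\<close>, two derived ones by
  \<open>comb_swap\<close>; a mixed swap changes only the sorting sign.\<close>

lemma supersym_\<Phi>: "supersym q \<Phi>"
  unfolding supersym_def
proof (intro allI)
  fix u v and c d :: "'x mag \<times> nat"
  obtain a n b m where cd: "c = (a, n)" "d = (b, m)" by (cases c, cases d)
  show "\<Phi> (u @ c # d # v) = sg (q c \<and> q d) (\<Phi> (u @ d # c # v))"
  proof (cases n)
    case 0
    show ?thesis
    proof (cases m)
      case 0
      show ?thesis
        using \<open>n = 0\<close> 0 supersymD[OF supersym_comb, of "asw u @ asw v" "ysw u" a b "ysw v"]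
        by (simp add: \<Phi>_def wfun_def cd sgw_append) (rule sg_cong, auto)
    next
      case (Suc m')
      show ?thesis
        using \<open>n = 0\<close> Suc
        by (simp add: \<Phi>_def wfun_def cd sgw_append) (rule sg_cong, auto)
    qed
  next
    case (Suc n')
    show ?thesis
    proof (cases m)
      case 0
      show ?thesis
        using Suc 0
        by (simp add: \<Phi>_def wfun_def cd sgw_append) (rule sg_cong, auto)
    next
      case (Suc m')
      show ?thesis
        using \<open>n = Suc n'\<close> Suc comb_swap[of "asw u" "(a, n')" "(b, m')" "asw v" "ysw u @ ysw v"]
        by (simp add: \<Phi>_def wfun_def cd sgw_append) (rule sg_cong, auto)
    qed
  qed
qed

lemma supp_\<Phi>: "supp (- 1) \<Phi>"
proof -
  have "wt w = (\<Sum>c\<leftarrow>asw w. int (snd c)) - int (length (ysw w))" for w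
    by (induction w) (simp_all split: nat.split)
  moreover have "(\<Sum>c\<leftarrow>as. int (snd c)) = int (sum_list (map snd as))" for as :: "('x mag \<times> nat) list"
    by (induction as) simp_all
  ultimately have "wt w = int (sum_list (map snd (asw w))) - int (length (ysw w))" for w by simp
  then have "\<Phi> w = 0" if "wt w \<noteq> - 1" for w
    using that comb_length[of "ysw w" "asw w"] by (force simp: \<Phi>_def wfun_def)
  then show ?thesis by (simp add: supp_def)
qed

lemma \<Phi>_leaf: "\<Phi> [(t, 0)] = e t"
  by (simp add: \<Phi>_def wfun_def)

text \<open>An underived letter enters \<open>\<Phi>\<close> only through its value, linearly up to
  a parity sign. Hence homogeneous linear relations between values pass to words.\<close>

lemma \<Phi>_move: "\<exists>Q s. lin Q \<and> (\<forall>t. \<Phi> ((t, 0) # w) = sg (p t \<and> s) (Q (e t)))"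
proof -
  obtain Q where Q: "Rop (lpar p (ysw w) \<noteq> opar (asw w)) Q"
    "\<And>z. comb (asw w) (ysw w @ [z]) = sg (p z \<and> opar (asw w)) (Q (e z))"
    using comb_snoc by blast
  have "\<Phi> ((t, 0) # w) = sg (p t \<and> (lpar p (ysw w) \<noteq> opar (asw w))) (sg (sgw w) (Q (e t)))" for t
    using supersym_move[OF supersym_comb, of "asw w" "[]" t "ysw w" "[]"]
    by (simp add: \<Phi>_def wfun_def Q(2)) (rule sg_cong, auto)
  moreover have "lin (\<lambda>f. sg (sgw w) (Q f))"
    by (rule Rop_lin[OF Rop_sg[OF Q(1)]])
  ultimately show ?thesis by blast
qed

text \<open>The letter \<open>(b, Suc 0)\<close> takes no arguments, so its operator is
  \<open>\<rho> b\<close>; commuting \<open>Q\<close> past it reduces the claim to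
  \<open>\<rho>_e\<close>.\<close>

lemma \<Phi>_MNode: "\<Phi> ((MNode a b, 0) # w) = \<Phi> ((a, 0) # (b, Suc 0) # w)"
proof -
  let ?ys = "ysw w" and ?as = "asw w"
  obtain Q where Q: "Rop (lpar p ?ys \<noteq> opar ?as) Q"
    "\<And>z. comb ?as (?ys @ [z]) = sg (p z \<and> opar ?as) (Q (e z))"
    using comb_snoc by blast
  have 1: "comb ?as (z # ?ys) = sg (p z \<and> (lpar p ?ys \<noteq> opar ?as)) (Q (e z))" for z
    using supersym_move[OF supersym_comb, of ?as "[]" z ?ys "[]"]
    by (simp add: Q(2)) (rule sg_cong, auto)
  have 2: "Q (e (MNode a b)) = sg (p a \<and> p b) (sg (p b \<and> (lpar p ?ys \<noteq> opar ?as)) (\<rho> b (Q (e a))))"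
    unfolding Rop_\<rho>_commute[OF Q(1), symmetric] lin_sg[OF Rop_lin[OF Q(1)], symmetric] \<rho>_e
    by (simp add: conj_commute)
  show ?thesis
    by (simp add: \<Phi>_def wfun_def 1 2 lin_sg[OF lin_\<rho>]) (rule sg_cong, auto)
qed

primrec wslot :: "'x mag \<Rightarrow> (('x mag \<times> nat) list \<Rightarrow> 'v) \<Rightarrow> ('x mag \<times> nat) list \<Rightarrow> 'v" where
  "wslot y H [] = 0"
| "wslot y H (c # w) = (if snd c = 0 then H ((MNode y (fst c), 0) # w) else 0)
      + sg (p y \<and> q c) (wslot y (\<lambda>w. H (c # w)) w)"

primrec dpos :: "(('x mag \<times> nat) list \<Rightarrow> 'v) \<Rightarrow> ('x mag \<times> nat) list \<Rightarrow> 'v" where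
  "dpos H [] = 0"
| "dpos H (c # w) = (if snd c = 0 then 0 else H ((fst c, Suc (snd c)) # w)) + dpos (\<lambda>w. H (c # w)) w"

lemma dpos_sg: "dpos (\<lambda>w. sg b (H w)) w = sg b (dpos H w)"
  by (induction w arbitrary: H) (simp_all add: sg_add)

text \<open>An underived letter \<open>b\<close> hit by \<open>D\<close> merges with
  \<open>y\<close> into the tree \<open>MNode y b\<close>, after \<open>y\<close> has been moved
  next to it. The derived letters are left to \<open>dpos\<close>.\<close>

lemma dw_split:
  assumes "supersym q H"
    and "\<And>u a b v. H (u @ (MNode a b, 0) # v) = H (u @ (a, 0) # (b, Suc 0) # v)"
  shows "dw (\<lambda>w. H ((y, 0) # w)) w = wslot y H w + dpos (\<lambda>w. H ((y, 0) # w)) w"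
  using assms
proof (induction w arbitrary: H)
  case (Cons c w)
  let ?H = "\<lambda>w. H (c # w)"
  have sym: "supersym q ?H"
    using Cons.prems(1) unfolding supersym_def by (metis append_Cons)
  have merge: "?H (u @ (MNode a b, 0) # v) = ?H (u @ (a, 0) # (b, Suc 0) # v)" for u a b v
    using Cons.prems(2)[of "c # u"] by simp
  have sw: "H ((y, 0) # c # w) = sg (p y \<and> q c) (?H ((y, 0) # w))" for w
    using supersymD[OF Cons.prems(1), of "[]" "(y, 0)" c w] by simp
  have "H ((MNode y (fst c), 0) # w) = H ((y, 0) # (fst c, Suc 0) # w)"
    using Cons.prems(2)[of "[]" y "fst c" w] by simp
  then show ?case
    using Cons.IH[OF sym merge]
    by (simp add: sw dw_lin[OF lin_sgn] dpos_sg sg_add add_ac)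
qed simp

lemma wslot_wfun: "wslot y (wfun G) w = sg (sgw w) (slotsum p y (G (asw w)) (ysw w))"
proof (induction w arbitrary: G)
  case (Cons c w)
  show ?case
  proof (cases "snd c")
    case 0
    then have 1: "(\<lambda>w. wfun G (c # w)) = wfun (\<lambda>as ys. G as (fst c # ys))"
      by (simp add: wfun_def fun_eq_iff)
    show ?thesis
      unfolding wslot.simps 1 Cons.IH using 0 by (simp add: wfun_def sg_add) (rule sg_cong, auto)
  next
    case (Suc n)
    then have 1: "(\<lambda>w. wfun G (c # w)) = wfun (\<lambda>as ys. sg (q c \<and> lpar p ys) (G ((fst c, n) # as) ys))"
      by (auto simp: wfun_def fun_eq_iff intro!: sg_cong)
    have 2: "slotsum p y (\<lambda>ys. sg (q c \<and> lpar p ys) (G ((fst c, n) # asw w) ys)) (ysw w)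
       = sg (q c \<and> (lpar p (ysw w) \<noteq> p y)) (slotsum p y (G ((fst c, n) # asw w)) (ysw w))"
      unfolding slotsum_sg[symmetric] by (rule slotsum_cong) simp
    show ?thesis
      unfolding wslot.simps 1 Cons.IH 2 using Suc by simp (rule sg_cong, auto)
  qed
qed simp

lemma dpos_wfun: "dpos (wfun G) w = sg (sgw w) (dlast (\<lambda>as. G as (ysw w)) (asw w))"
proof (induction w arbitrary: G)
  case (Cons c w)
  show ?case
  proof (cases "snd c")
    case 0
    then have 1: "(\<lambda>w. wfun G (c # w)) = wfun (\<lambda>as ys. G as (fst c # ys))"
      by (simp add: wfun_def fun_eq_iff)
    show ?thesis
      unfolding dpos.simps 1 Cons.IH using 0 by simp
  next
    case (Suc n)
    then have 1: "(\<lambda>w. wfun G (c # w)) = wfun (\<lambda>as ys. sg (q c \<and> lpar p ys) (G ((fst c, n) # as) ys))"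
      by (auto simp: wfun_def fun_eq_iff intro!: sg_cong)
    show ?thesis
      unfolding dpos.simps 1 Cons.IH dlast_lin[OF lin_sgn, symmetric] using Suc
      by (simp add: wfun_def sg_add) (rule sg_cong, auto)
  qed
qed simp

text \<open>\<open>dw_split\<close> divides the derivative into exactly the two sums of
  \<open>L_comb\<close>; the merging rule that it needs is \<open>\<Phi>_MNode\<close> moved into
  the middle of a word.\<close>

lemma dw_\<Phi>: "dw (\<lambda>w. \<Phi> ((y, 0) # w)) w = L y (\<Phi> w)"
proof -
  have 1: "\<Phi> (u @ (MNode a b, 0) # v) = \<Phi> (u @ (a, 0) # (b, Suc 0) # v)" for u a b v
    using supersym_swap[OF supersym_\<Phi>, of u "[(MNode a b, 0)]" v]
      supersym_swap[OF supersym_\<Phi>, of u "[(a, 0), (b, Suc 0)]" v] \<Phi>_MNode[of a b "u @ v"]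
    by simp
  have 2: "(\<lambda>w. \<Phi> ((y, 0) # w)) = wfun (\<lambda>as ys. comb as (y # ys))"
    by (simp add: \<Phi>_def wfun_def fun_eq_iff)
  have "dw (\<lambda>w. \<Phi> ((y, 0) # w)) w = wslot y \<Phi> w + dpos (\<lambda>w. \<Phi> ((y, 0) # w)) w"
    by (rule dw_split[OF supersym_\<Phi> 1])
  also have "\<dots> = sg (sgw w) (L y (comb (asw w) (ysw w)))"
    unfolding 2 dpos_wfun unfolding \<Phi>_def wslot_wfun L_comb sg_add ..
  finally show ?thesis
    by (simp add: \<Phi>_def wfun_def lin_sg[OF lin_L])
qed

text \<open>The model is \<open>F H w = H (f w)\<close> for an element \<open>f\<close> of parity
  \<open>r\<close> and weight \<open>d\<close>. The fourth condition says that \<open>f\<close>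
  supercommutes with letters.\<close>

definition homog_op :: "bool \<Rightarrow> int \<Rightarrow> ((('x mag \<times> nat) list \<Rightarrow> 'v) \<Rightarrow> ('x mag \<times> nat) list \<Rightarrow> 'v) \<Rightarrow> bool" where
  "homog_op r d F \<longleftrightarrow>
     (\<forall>H G. F (\<lambda>w. H w + G w) = (\<lambda>w. F H w + F G w)) \<and>
     (\<forall>T H. lin T \<longrightarrow> F (\<lambda>w. T (H w)) = (\<lambda>w. T (F H w))) \<and>
     (\<forall>H. supersym q H \<longrightarrow> supersym q (F H)) \<and>
     (\<forall>c H. supersym q H \<longrightarrow> F (\<lambda>w. H (c # w)) = (\<lambda>w. sg (r \<and> q c) (F H (c # w)))) \<and>
     (\<forall>m H. supp m H \<longrightarrow> supp (m - d) (F H))"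

lemma homog_op_add: "homog_op r d F \<Longrightarrow> F (\<lambda>w. H w + G w) = (\<lambda>w. F H w + F G w)"
  and homog_op_lin: "homog_op r d F \<Longrightarrow> lin T \<Longrightarrow> F (\<lambda>w. T (H w)) = (\<lambda>w. T (F H w))"
  and homog_op_sym: "homog_op r d F \<Longrightarrow> supersym q H \<Longrightarrow> supersym q (F H)"
  and homog_op_letter: "homog_op r d F \<Longrightarrow> supersym q H \<Longrightarrow> F (\<lambda>w. H (c # w)) = (\<lambda>w. sg (r \<and> q c) (F H (c # w)))"
  and homog_op_supp: "homog_op r d F \<Longrightarrow> supp m H \<Longrightarrow> supp (m - d) (F H)"
  unfolding homog_op_def by blast+

lemma homog_op_zero: "homog_op r d F \<Longrightarrow> F (\<lambda>w. 0) = (\<lambda>w. 0)"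
  using homog_op_lin[of r d F "\<lambda>f. 0" "\<lambda>w. 0"] by (simp add: lin_def)

lemma homog_op_diff: "homog_op r d F \<Longrightarrow> F (\<lambda>w. H w - G w) = (\<lambda>w. F H w - F G w)"
  using homog_op_add[of r d F H "\<lambda>w. - G w"] homog_op_lin[OF _ lin_minus, of r d F G] by simp

lemma supersym_letter:
  assumes "supersym q H"
  shows "supersym q (\<lambda>w. H (c # w))"
  using assms unfolding supersym_def by (metis append_Cons)

lemma supersym_lin: "lin T \<Longrightarrow> supersym q H \<Longrightarrow> supersym q (\<lambda>w. T (H w))"
  unfolding supersym_def using lin_sg by metis

lemma supersym_diff: "supersym q H \<Longrightarrow> supersym q G \<Longrightarrow> supersym q (\<lambda>w. H w - G w)"
  unfolding supersym_def sg_diff by metis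

lemma supersym_sum:
  fixes H :: "'t \<Rightarrow> ('x mag \<times> nat) list \<Rightarrow> 'v"
  assumes "\<And>t. t \<in> A \<Longrightarrow> supersym q (H t)"
  shows "supersym q (\<lambda>w. \<Sum>t\<in>A. H t w)"
  unfolding supersym_def lin_sum[OF lin_sgn]
  by (intro allI sum.cong refl) (erule supersymD[OF assms])

lemma lin_scale_op: "lin (scale c)"
  by (rule linI) (simp_all add: scale_right_distrib mult.commute)

lemma homog_op_leaf: "homog_op (q c) (int (snd c) - 1) (\<lambda>H w. H (c # w))"
  unfolding homog_op_def
proof (intro conjI allI impI)
  fix d and H :: "('x mag \<times> nat) list \<Rightarrow> 'v" assume H: "supersym q H"
  show "(\<lambda>w. H (d # c # w)) = (\<lambda>w. sg (q c \<and> q d) (H (c # d # w)))"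
    using supersymD[OF H, of "[]" d c] by (simp add: conj_commute)
qed (simp_all add: supp_def supersym_letter)

lemma homog_op_compose:
  assumes F: "homog_op r d F" and F': "homog_op r' d' F'"
  shows "homog_op (r \<noteq> r') (d + d') (\<lambda>H. F' (F H))"
  unfolding homog_op_def
proof (intro conjI allI impI)
  fix c and H :: "('x mag \<times> nat) list \<Rightarrow> 'v" assume H: "supersym q H"
  have "F' (F (\<lambda>w. H (c # w))) = F' (\<lambda>w. sg (r \<and> q c) (F H (c # w)))"
    by (simp add: homog_op_letter[OF F H])
  also have "\<dots> = (\<lambda>w. sg (r \<and> q c) (sg (r' \<and> q c) (F' (F H) (c # w))))"
    by (simp add: homog_op_lin[OF F' lin_sgn] homog_op_letter[OF F' homog_op_sym[OF F H]])
  finally show "F' (F (\<lambda>w. H (c # w))) = (\<lambda>w. sg ((r \<noteq> r') \<and> q c) (F' (F H) (c # w)))"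
    by (rule trans) (simp, intro ext sg_cong, auto)
next
  fix m H assume "supp m H"
  then have "supp (m - d - d') (F' (F H))" by (intro homog_op_supp[OF F'] homog_op_supp[OF F])
  then show "supp (m - (d + d')) (F' (F H))" by (simp add: diff_diff_add)
qed (simp_all add: homog_op_add[OF F] homog_op_add[OF F'] homog_op_lin[OF F] homog_op_lin[OF F'] homog_op_sym[OF F] homog_op_sym[OF F'])

lemma homog_op_minus:
  assumes F: "homog_op r d F" and F': "homog_op r d F'"
  shows "homog_op r d (\<lambda>H w. F H w - F' H w)"
  unfolding homog_op_def
proof (intro conjI allI impI)
  fix H :: "('x mag \<times> nat) list \<Rightarrow> 'v" assume H: "supersym q H"
  show "supersym q (\<lambda>w. F H w - F' H w)"
    by (intro supersym_diff homog_op_sym[OF F H] homog_op_sym[OF F' H])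
next
  fix m H assume "supp m H"
  then show "supp (m - d) (\<lambda>w. F H w - F' H w)"
    using homog_op_supp[OF F] homog_op_supp[OF F'] unfolding supp_def by (metis diff_self)
qed (simp_all add: homog_op_add[OF F] homog_op_add[OF F'] homog_op_lin[OF F] homog_op_lin[OF F'] homog_op_letter[OF F] homog_op_letter[OF F']
  sg_diff lin_diff add_diff_swap)

lemma homog_op_sum:
  assumes "\<And>t. t \<in> A \<Longrightarrow> p t = r"
  shows "homog_op r (- 1) (\<lambda>H w. \<Sum>t\<in>A. scale (c t) (H ((t, 0) # w)))"
  unfolding homog_op_def
proof (intro conjI allI impI)
  fix H :: "('x mag \<times> nat) list \<Rightarrow> 'v" assume H: "supersym q H"
  show "supersym q (\<lambda>w. \<Sum>t\<in>A. scale (c t) (H ((t, 0) # w)))"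
    by (intro supersym_sum supersym_lin[OF lin_scale_op] supersym_letter[OF H])
  fix d
  have "(\<Sum>t\<in>A. scale (c t) (H (d # (t, 0) # w))) = sg (r \<and> q d) (\<Sum>t\<in>A. scale (c t) (H ((t, 0) # d # w)))" for w
    unfolding lin_sum[OF lin_sgn] using assms supersymD[OF H, of "[]" d "(_, 0)" w]
    by (intro sum.cong) (auto simp: conj_commute lin_scale[OF lin_sgn])
  then show "(\<lambda>w. \<Sum>t\<in>A. scale (c t) (H (d # (t, 0) # w))) = (\<lambda>w. sg (r \<and> q d) (\<Sum>t\<in>A. scale (c t) (H ((t, 0) # d # w))))"
    by simp
qed (simp_all add: supp_def scale_right_distrib sum.distrib lin_sum lin_scale)

text \<open>If \<open>F\<close> is multiplication by \<open>f\<close>, then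
  \<open>H (D (f w)) - H (f (D w)) = H ((D f) w)\<close>, so \<open>ad F\<close> is multiplication
  by \<open>D f\<close>.\<close>

definition ad :: "((('x mag \<times> nat) list \<Rightarrow> 'v) \<Rightarrow> ('x mag \<times> nat) list \<Rightarrow> 'v) \<Rightarrow> (('x mag \<times> nat) list \<Rightarrow> 'v) \<Rightarrow> ('x mag \<times> nat) list \<Rightarrow> 'v" where
  "ad F H = (\<lambda>w. F (dw H) w - dw (F H) w)"

lemma dw_letter: "dw (\<lambda>w. H (c # w)) = (\<lambda>w. dw H (c # w) - H ((fst c, Suc (snd c)) # w))"
  by simp

lemma homog_op_ad:
  assumes F: "homog_op r d F"
  shows "homog_op r (d + 1) (ad F)"
  unfolding homog_op_def
proof (intro conjI allI impI)
  fix H G :: "('x mag \<times> nat) list \<Rightarrow> 'v"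
  have "dw (\<lambda>w. H w + G w) = (\<lambda>w. dw H w + dw G w)" by (rule ext) (rule dw_add)
  then show "ad F (\<lambda>w. H w + G w) = (\<lambda>w. ad F H w + ad F G w)"
    by (simp add: ad_def homog_op_add[OF F] dw_add add_diff_swap)
next
  fix T and H :: "('x mag \<times> nat) list \<Rightarrow> 'v" assume T: "lin T"
  have "dw (\<lambda>w. T (H w)) = (\<lambda>w. T (dw H w))" by (rule ext) (rule dw_lin[OF T])
  then show "ad F (\<lambda>w. T (H w)) = (\<lambda>w. T (ad F H w))"
    by (simp add: ad_def homog_op_lin[OF F T] dw_lin[OF T] lin_diff[OF T])
next
  fix H :: "('x mag \<times> nat) list \<Rightarrow> 'v" assume "supersym q H"
  then have "supersym q (F (dw H))" "supersym q (dw (F H))"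
    by (simp_all add: homog_op_sym[OF F] supersym_dw)
  then show "supersym q (ad F H)"
    unfolding ad_def by (rule supersym_diff)
next
  fix c and H :: "('x mag \<times> nat) list \<Rightarrow> 'v" assume H: "supersym q H"
  have "F (dw (\<lambda>w. H (c # w))) = (\<lambda>w. sg (r \<and> q c) (F (dw H) (c # w)) - sg (r \<and> q c) (F H ((fst c, Suc (snd c)) # w)))"
    using homog_op_letter[OF F H, of "(fst c, Suc (snd c))"]
    unfolding dw_letter homog_op_diff[OF F] homog_op_letter[OF F supersym_dw[OF H]] by simp
  moreover have "dw (F (\<lambda>w. H (c # w))) = (\<lambda>w. sg (r \<and> q c) (dw (F H) (c # w)) - sg (r \<and> q c) (F H ((fst c, Suc (snd c)) # w)))"
    unfolding homog_op_letter[OF F H] by (simp add: dw_lin[OF lin_sgn] ext sg_add)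
  ultimately show "ad F (\<lambda>w. H (c # w)) = (\<lambda>w. sg (r \<and> q c) (ad F H (c # w)))"
    by (simp add: ad_def sg_diff)
next
  fix m H assume H: "supp m H"
  have "supp (m - (d + 1)) (F (dw H))"
    using homog_op_supp[OF F supp_dw[OF H]] by (simp add: algebra_simps)
  moreover have "supp (m - (d + 1)) (dw (F H))"
    using supp_dw[OF homog_op_supp[OF F H]] by (simp add: algebra_simps)
  ultimately show "supp (m - (d + 1)) (ad F H)"
    unfolding supp_def ad_def by simp
qed

lemma homog_op_ad_pow: "homog_op r d F \<Longrightarrow> homog_op r (d + int k) ((ad ^^ k) F)"
proof (induction k)
  case (Suc k)
  then show ?case using homog_op_ad[of r "d + int k" "(ad ^^ k) F"] by (simp add: algebra_simps)
qed simp

text \<open>Only underived letters have negative weight, so the word contains one, and supersymmetry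
  brings it to the front.\<close>

lemma supersym_negative_weight:
  assumes sym: "supersym q K" and zero: "\<And>y w. K ((y, 0) # w) = 0" and neg: "wt w < 0"
  shows "K w = 0"
proof -
  have "\<exists>c\<in>set w. snd c = 0"
    using neg
  proof (induction w)
    case (Cons c w)
    then show ?case by (cases "snd c = 0") auto
  qed simp
  then obtain c where c: "c \<in> set w" "snd c = 0" by blast
  then obtain u v where "w = u @ c # v" by (meson split_list)
  then have "K w = sg (lpar q u \<and> q c) (K (c # u @ v))"
    using supersym_swap[OF sym, of u "[c]" v] by simp
  then show ?thesis using zero[of "fst c" "u @ v"] c by (metis prod.collapse sg_simps(3))
qed

text \<open>The functional \<open>ad F \<Phi>\<close> lives on words of negative weight. Each of these contains some \<open>(y, 0)\<close>, which
  can be moved to the front, where \<open>dw_\<Phi>\<close> applies.\<close>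

lemma ad_\<Phi>:
  assumes F: "homog_op r d F" and "d \<ge> - 1" and 0: "F \<Phi> = (\<lambda>w. 0)"
  shows "ad F \<Phi> = (\<lambda>w. 0)"
proof
  fix w
  note ad = homog_op_ad[OF F]
  show "ad F \<Phi> w = 0"
  proof (cases "wt w = - 2 - d")
    case False
    then show ?thesis using homog_op_supp[OF ad supp_\<Phi>] unfolding supp_def by simp
  next
    case True
    show ?thesis
    proof (rule supersym_negative_weight)
      show "supersym q (ad F \<Phi>)" by (rule homog_op_sym[OF ad supersym_\<Phi>])
      show "wt w < 0" using True assms(2) by simp
      fix y w
      \<comment> \<open>\<open>D (y w)\<close> is \<open>(D y) w\<close> plus \<open>y D(w)\<close>.
        Since \<open>F\<close> commutes with \<open>L y\<close> and, up to sign, with prepending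
        \<open>D y\<close>, both parts reduce to \<open>F \<Phi> = 0\<close>.\<close>
      have "F (\<lambda>w. dw \<Phi> ((y, 0) # w)) = F (\<lambda>w. \<Phi> ((y, Suc 0) # w) + L y (\<Phi> w))"
        by (simp add: dw_\<Phi>)
      also have "\<dots> = (\<lambda>w. 0)"
        unfolding homog_op_add[OF F] homog_op_lin[OF F lin_L] homog_op_letter[OF F supersym_\<Phi>] 0
        by (simp add: lin_0[OF lin_L])
      finally have "sg (r \<and> p y) (F (dw \<Phi>) ((y, 0) # w)) = 0"
        unfolding homog_op_letter[OF F supersym_dw[OF supersym_\<Phi>]] by (simp add: fun_eq_iff)
      then have "F (dw \<Phi>) ((y, 0) # w) = 0" by (simp add: sg_def split: if_splits)
      then show "ad F \<Phi> ((y, 0) # w) = 0"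
        unfolding ad_def 0 by (simp add: lin_0[OF lin_L])
    qed
  qed
qed

lemma ad_pow_\<Phi>:
  assumes F: "homog_op r d F" and "d \<ge> - 1" and 0: "F \<Phi> = (\<lambda>w. 0)"
  shows "(ad ^^ k) F \<Phi> = (\<lambda>w. 0)"
proof (induction k)
  case (Suc k)
  then show ?case using ad_\<Phi>[OF homog_op_ad_pow[OF F, of k]] assms(2) by simp
qed (simp add: 0)

end

subsection \<open>Linear extensions\<close>

lemma lookup_lsmult: "Poly_Mapping.lookup (lsmult c f) t = c * Poly_Mapping.lookup f t"
  by (simp add: lsmult_def Poly_Mapping.map.rep_eq when_def)

lemma vector_space_lsmult: "vector_space (lsmult :: 'k::field \<Rightarrow> ('t \<Rightarrow>\<^sub>0 'k) \<Rightarrow> 't \<Rightarrow>\<^sub>0 'k)"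
  by unfold_locales (auto intro!: poly_mapping_eqI simp: lookup_lsmult lookup_add algebra_simps)

context vector_space
begin

text \<open>\<open>lin_ext\<close> only takes values in finitely supported functions; the abstract
  target of the locale needs the same construction in any vector space.\<close>

definition lext :: "('t \<Rightarrow> 'b) \<Rightarrow> ('t \<Rightarrow>\<^sub>0 'a) \<Rightarrow> 'b" where
  "lext h f = (\<Sum>t\<in>Poly_Mapping.keys f. scale (Poly_Mapping.lookup f t) (h t))"

lemma lext_superset:
  assumes "finite A" "Poly_Mapping.keys f \<subseteq> A"
  shows "lext h f = (\<Sum>t\<in>A. scale (Poly_Mapping.lookup f t) (h t))"
  unfolding lext_def using assms by (intro sum.mono_neutral_left) (auto simp: in_keys_iff)

lemma lext_add: "lext h (f + g) = lext h f + lext h g"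
proof -
  let ?A = "Poly_Mapping.keys f \<union> Poly_Mapping.keys g"
  have "Poly_Mapping.keys (f + g) \<subseteq> ?A" by (rule Poly_Mapping.keys_add)
  then show ?thesis
    by (simp add: lext_superset[of ?A] lookup_add scale_left_distrib sum.distrib)
qed

lemma lext_lsmult: "lext h (lsmult c f) = scale c (lext h f)"
proof -
  have "Poly_Mapping.keys (lsmult c f) \<subseteq> Poly_Mapping.keys f"
    by (auto simp: in_keys_iff lookup_lsmult)
  then show ?thesis
    by (simp add: lext_superset[of "Poly_Mapping.keys f"] lookup_lsmult scale_sum_right)
qed

lemma lext_single: "lext h (Poly_Mapping.single t c) = scale c (h t)"
  by (simp add: lext_superset[of "{t}"])

lemma lext_0 [simp]: "lext h 0 = 0"
  by (simp add: lext_def)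

lemma lext_uminus: "lext h (- f) = - lext h f"
  using lext_add[of h f "- f"] by (simp add: eq_neg_iff_add_eq_0 add.commute)

lemma lext_diff: "lext h (f - g) = lext h f - lext h g"
  using lext_add[of h f "- g"] lext_uminus[of h g] by simp

lemma lext_cong: "(\<And>t. t \<in> Poly_Mapping.keys f \<Longrightarrow> h t = h' t) \<Longrightarrow> lext h f = lext h' f"
  by (simp add: lext_def)

lemma lext_add_fun: "lext (\<lambda>t. h t + h' t) f = lext h f + lext h' f"
  by (simp add: lext_def scale_right_distrib sum.distrib)

lemma lext_uminus_fun: "lext (\<lambda>t. - h t) f = - lext h f"
  by (simp add: lext_def sum_negf)

lemma lext_diff_fun: "lext (\<lambda>t. h t - h' t) f = lext h f - lext h' f"
  using lext_add_fun[of h "\<lambda>t. - h' t"] by (simp add: lext_uminus_fun)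

lemma lext_zero_fun [simp]: "lext (\<lambda>t. 0) f = 0"
  by (simp add: lext_def)

lemma lext_scale_fun: "lext (\<lambda>t. scale c (h t)) f = scale c (lext h f)"
  by (simp add: lext_def scale_sum_right mult.commute)

lemma lext_swap: "lext (\<lambda>s. lext (h s) g) f = lext (\<lambda>t. lext (\<lambda>s. h s t) f) g"
  unfolding lext_def scale_sum_right by (subst sum.swap) (simp add: mult.commute)

lemma additive_lext:
  fixes T :: "('u \<Rightarrow>\<^sub>0 'a) \<Rightarrow> 'b" and h :: "'t \<Rightarrow> 'u \<Rightarrow>\<^sub>0 'a"
  assumes "\<And>f g. T (f + g) = T f + T g" "\<And>c f. T (lsmult c f) = scale c (T f)"
  shows "T (lin_ext h f) = lext (\<lambda>t. T (h t)) f"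
proof -
  have "T 0 = 0" using assms(1)[of 0 0] by simp
  then have "T (sum g A) = (\<Sum>x\<in>A. T (g x))" for g :: "'t \<Rightarrow> _" and A
    by (induction A rule: infinite_finite_induct) (simp_all add: assms(1))
  then show ?thesis by (simp add: lin_ext_def lext_def assms(2))
qed

end

interpretation pm: vector_space "lsmult :: 'k::field \<Rightarrow> ('t \<Rightarrow>\<^sub>0 'k) \<Rightarrow> 't \<Rightarrow>\<^sub>0 'k"
  by (rule vector_space_lsmult)

lemma lin_ext_eq_lext: "lin_ext h = pm.lext h"
  by (simp add: fun_eq_iff lin_ext_def pm.lext_def)

lemma lsmult_single: "lsmult c (Poly_Mapping.single t d) = Poly_Mapping.single t (c * d)"
  by (intro poly_mapping_eqI) (simp add: lookup_lsmult lookup_single when_def)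

lemma bilin_ext_eq: "bilin_ext op f g = lin_ext (\<lambda>s. lin_ext (\<lambda>t. Poly_Mapping.single (op s t) 1) g) f"
  by (simp add: bilin_ext_def lin_ext_def pm.scale_sum_right lsmult_single)

lemma lin_ext_single_id: "lin_ext (\<lambda>t. Poly_Mapping.single t 1) f = f"
proof (rule poly_mapping_eqI)
  fix x
  have "Poly_Mapping.lookup (lin_ext (\<lambda>t. Poly_Mapping.single t 1) f) x =
      (\<Sum>t\<in>Poly_Mapping.keys f. if t = x then Poly_Mapping.lookup f t else 0)"
    unfolding lin_ext_def lookup_sum
    by (intro sum.cong) (auto simp: lookup_lsmult lookup_single when_def)
  also have "\<dots> = Poly_Mapping.lookup f x"
    by (simp add: in_keys_iff)
  finally show "Poly_Mapping.lookup (lin_ext (\<lambda>t. Poly_Mapping.single t 1) f) x = Poly_Mapping.lookup f x" .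
qed

lemma (in vector_space) additive_eqI:
  assumes "\<And>f g. T (f + g) = T f + T g" "\<And>c f. T (lsmult c f) = scale c (T f)"
    and "\<And>f g. U (f + g) = U f + U g" "\<And>c f. U (lsmult c f) = scale c (U f)"
    and "\<And>t. T (Poly_Mapping.single t 1) = U (Poly_Mapping.single t 1)"
  shows "T f = U f"
  using additive_lext[of T "\<lambda>t. Poly_Mapping.single t 1" f] additive_lext[of U "\<lambda>t. Poly_Mapping.single t 1" f] assms
  by (simp add: lin_ext_single_id)

section \<open>Action of differential terms on functionals\<close>

context gdn_operators
begin

text \<open>Words multiply from left to right, hence the order of composition in \<open>DMul\<close>. Associativity and the
  Leibniz rule hold on the nose, because products are compositions and the derivation is a commutator.\<close>

primrec ev :: "'x dterm \<Rightarrow> (('x mag \<times> nat) list \<Rightarrow> 'v) \<Rightarrow> ('x mag \<times> nat) list \<Rightarrow> 'v" where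
  "ev (DLeaf x) = (\<lambda>H w. H ((MLeaf x, 0) # w))"
| "ev (DMul u v) = (\<lambda>H. ev v (ev u H))"
| "ev (DDer u) = ad (ev u)"

lemma homog_op_ev: "\<exists>d. homog_op (dpar par u) d (ev u)"
proof (induction u)
  case (DLeaf x)
  show ?case using homog_op_leaf[of "(MLeaf x, 0)"] by auto
next
  case (DMul u v)
  then show ?case unfolding ev.simps dpar.simps by (blast intro: homog_op_compose)
next
  case (DDer u)
  then show ?case unfolding ev.simps dpar.simps by (blast intro: homog_op_ad)
qed

lemma dw_good:
  assumes F: "homog_op r d F"
  shows "dw (F H) = (\<lambda>w. F (dw H) w - ad F H w)"
  by (simp add: ad_def)

text \<open>\<open>F\<close> ranges over all homogeneous operators because the case of a derivative
  needs the induction hypothesis for \<open>ad F\<close> as well.\<close>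

lemma ev_commute:
  "homog_op r d F \<Longrightarrow> supersym q H \<Longrightarrow> ev v (F H) = (\<lambda>w. sg (r \<and> dpar par v) (F (ev v H) w))"
proof (induction v arbitrary: F d H)
  case (DLeaf x)
  show ?case using homog_op_letter[OF DLeaf, of "(MLeaf x, 0)"]
    by (simp add: fun_eq_iff)
next
  case (DMul u v)
  obtain d1 d2 where u: "homog_op (dpar par u) d1 (ev u)" and v: "homog_op (dpar par v) d2 (ev v)"
    using homog_op_ev by blast
  have "ev v (ev u (F H)) = ev v (\<lambda>w. sg (r \<and> dpar par u) (F (ev u H) w))"
    by (simp only: DMul.IH(1)[OF DMul.prems])
  also have "\<dots> = (\<lambda>w. sg (r \<and> dpar par u) (sg (r \<and> dpar par v) (F (ev v (ev u H)) w)))"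
    by (simp only: homog_op_lin[OF v lin_sgn] DMul.IH(2)[OF DMul.prems(1) homog_op_sym[OF u DMul.prems(2)]])
  finally show ?case
    unfolding ev.simps by (rule trans) (simp, intro ext sg_cong, auto)
next
  case (DDer v)
  obtain d2 where v: "homog_op (dpar par v) d2 (ev v)"
    using homog_op_ev by blast
  let ?s = "r \<and> dpar par v"
  note F = DDer.prems(1) and H = DDer.prems(2)
  note H' = supersym_dw[OF H]
  have "ev v (dw (F H)) = (\<lambda>w. sg ?s (F (ev v (dw H)) w) - sg ?s (ad F (ev v H) w))"
    unfolding dw_good[OF F] homog_op_diff[OF v] DDer.IH[OF F H'] DDer.IH[OF homog_op_ad[OF F] H] ..
  moreover have "dw (ev v (F H)) = (\<lambda>w. sg ?s (dw (F (ev v H)) w))"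
    unfolding DDer.IH[OF F H] by (rule ext) (rule dw_lin[OF lin_sgn])
  moreover have "F (ad (ev v) H) = (\<lambda>w. F (ev v (dw H)) w - F (dw (ev v H)) w)"
    unfolding ad_def by (rule homog_op_diff[OF F])
  ultimately show ?case
    unfolding ev.simps dpar.simps by (simp add: ad_def sg_diff)
qed

text \<open>Letters are arbitrary trees, so two kinds of relations are imposed: a tree is the GDN
  product of its branches, and a homogeneous combination of trees with value zero is zero. Both
  kinds have weight \<open>-1\<close>, the least that \<open>ad_\<Phi>\<close> admits.\<close>

definition relop :: "((('x mag \<times> nat) list \<Rightarrow> 'v) \<Rightarrow> ('x mag \<times> nat) list \<Rightarrow> 'v) \<Rightarrow> bool" where
  "relop F \<longleftrightarrow> (\<exists>a b. F = (\<lambda>H w. H ((MNode a b, 0) # w) - H ((a, 0) # (b, Suc 0) # w))) \<or>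
     (\<exists>f r. (\<forall>t\<in>Poly_Mapping.keys f. p t = r) \<and> lext e f = 0 \<and> F = (\<lambda>H w. lext (\<lambda>t. H ((t, 0) # w)) f))"

lemma homog_op_relop:
  assumes "relop F"
  shows "\<exists>r. homog_op r (- 1) F"
  using assms unfolding relop_def
proof (elim disjE exE conjE)
  fix a b assume F: "F = (\<lambda>H w. H ((MNode a b, 0) # w) - H ((a, 0) # (b, Suc 0) # w))"
  have "homog_op (p a \<noteq> p b) (- 1) (\<lambda>H w. H ((a, 0) # (b, Suc 0) # w))"
    using homog_op_compose[OF homog_op_leaf[of "(a, 0)"] homog_op_leaf[of "(b, Suc 0)"]] by simp
  moreover have "homog_op (p a \<noteq> p b) (- 1) (\<lambda>H w. H ((MNode a b, 0) # w))"
    using homog_op_leaf[of "(MNode a b, 0)"] by simp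
  ultimately have "homog_op (p a \<noteq> p b) (- 1) F"
    unfolding F by (intro homog_op_minus)
  then show ?thesis ..
next
  fix f r assume "\<forall>t\<in>Poly_Mapping.keys f. p t = r" and F: "F = (\<lambda>H w. lext (\<lambda>t. H ((t, 0) # w)) f)"
  then have "homog_op r (- 1) F"
    unfolding F lext_def by (intro homog_op_sum) simp
  then show ?thesis ..
qed

lemma lin_lext: "lin T \<Longrightarrow> T (lext h f) = lext (\<lambda>t. T (h t)) f"
  by (simp add: lext_def lin_sum lin_scale)

lemma relop_\<Phi>:
  assumes "relop F"
  shows "F \<Phi> = (\<lambda>w. 0)"
  using assms unfolding relop_def
proof (elim disjE exE conjE)
  fix a b assume F: "F = (\<lambda>H w. H ((MNode a b, 0) # w) - H ((a, 0) # (b, Suc 0) # w))"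
  show ?thesis unfolding F \<Phi>_MNode by simp
next
  fix f r assume r: "\<forall>t\<in>Poly_Mapping.keys f. p t = r" and 0: "lext e f = 0"
    and F: "F = (\<lambda>H w. lext (\<lambda>t. H ((t, 0) # w)) f)"
  show ?thesis
  proof
    fix w
    obtain Q s where Q: "lin Q" "\<And>t. \<Phi> ((t, 0) # w) = sg (p t \<and> s) (Q (e t))"
      using \<Phi>_move by blast
    have "F \<Phi> w = lext (\<lambda>t. sg (r \<and> s) (Q (e t))) f"
      unfolding F Q(2) using r by (intro lext_cong) simp
    also have "\<dots> = sg (r \<and> s) (Q (lext e f))"
      by (simp add: lin_lext[OF Q(1)] lin_lext[OF lin_sgn])
    finally show "F \<Phi> w = 0" by (simp add: 0 lin_0[OF Q(1)])
  qed
qed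

text \<open>The supersymmetric functionals that kill the relations and all their derivatives. This
  class is closed under the operators that occur, so an induction over the ideal can run inside it;
  \<open>\<Phi>\<close> alone would not be preserved.\<close>

definition solves :: "(('x mag \<times> nat) list \<Rightarrow> 'v) \<Rightarrow> bool" where
  "solves H \<longleftrightarrow> supersym q H \<and> (\<forall>F k. relop F \<longrightarrow> (ad ^^ k) F H = (\<lambda>w. 0))"

lemma solves_sym: "solves H \<Longrightarrow> supersym q H"
  and solves_relop: "solves H \<Longrightarrow> relop F \<Longrightarrow> (ad ^^ k) F H = (\<lambda>w. 0)"
  by (simp_all add: solves_def)

lemma solves_\<Phi>: "solves \<Phi>"
  unfolding solves_def using supersym_\<Phi> homog_op_relop relop_\<Phi> ad_pow_\<Phi> by (metis order_refl)

lemma solves_letter: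
  assumes H: "solves H"
  shows "solves (\<lambda>w. H (c # w))"
  unfolding solves_def
proof (intro conjI allI impI)
  show "supersym q (\<lambda>w. H (c # w))" by (rule supersym_letter[OF solves_sym[OF H]])
  fix F k assume F: "relop F"
  obtain r where "homog_op r (- 1) F" using homog_op_relop[OF F] ..
  from homog_op_letter[OF homog_op_ad_pow[OF this] solves_sym[OF H]]
  show "(ad ^^ k) F (\<lambda>w. H (c # w)) = (\<lambda>w. 0)"
    by (simp add: solves_relop[OF H F])
qed

lemma solves_dw:
  assumes H: "solves H"
  shows "solves (dw H)"
  unfolding solves_def
proof (intro conjI allI impI)
  show "supersym q (dw H)" by (rule supersym_dw[OF solves_sym[OF H]])
  fix F k assume F: "relop F"
  have "ad ((ad ^^ k) F) H = (\<lambda>w. 0)"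
    using solves_relop[OF H F, of "Suc k"] by simp
  then show "(ad ^^ k) F (dw H) = (\<lambda>w. 0)"
    unfolding ad_def solves_relop[OF H F] by (simp add: fun_eq_iff)
qed

lemma solves_diff:
  assumes "solves H" "solves G"
  shows "solves (\<lambda>w. H w - G w)"
  unfolding solves_def
proof (intro conjI allI impI)
  show "supersym q (\<lambda>w. H w - G w)" by (intro supersym_diff solves_sym assms)
  fix F k assume F: "relop F"
  obtain r where "homog_op r (- 1) F" using homog_op_relop[OF F] ..
  from homog_op_diff[OF homog_op_ad_pow[OF this]]
  show "(ad ^^ k) F (\<lambda>w. H w - G w) = (\<lambda>w. 0)"
    by (simp add: solves_relop[OF _ F] assms)
qed

lemma solves_lin:
  assumes "lin T" "solves H"
  shows "solves (\<lambda>w. T (H w))"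
  unfolding solves_def
proof (intro conjI allI impI)
  show "supersym q (\<lambda>w. T (H w))" by (rule supersym_lin[OF assms(1) solves_sym[OF assms(2)]])
  fix F k assume F: "relop F"
  obtain r where "homog_op r (- 1) F" using homog_op_relop[OF F] ..
  from homog_op_lin[OF homog_op_ad_pow[OF this] assms(1)]
  show "(ad ^^ k) F (\<lambda>w. T (H w)) = (\<lambda>w. 0)"
    by (simp add: solves_relop[OF _ F] assms lin_0)
qed

lemma solves_sum:
  assumes "\<And>t. t \<in> A \<Longrightarrow> solves (H t)"
  shows "solves (\<lambda>w. \<Sum>t\<in>A. H t w)"
  using assms
proof (induction A rule: infinite_finite_induct)
  case (insert x A)
  have "solves (\<lambda>w. H x w - - (\<Sum>t\<in>A. H t w))"
    using insert by (intro solves_diff solves_lin[OF lin_minus]) auto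
  then show ?case using insert by simp
qed (use solves_lin[OF _ solves_\<Phi>, of "\<lambda>f. 0"] in \<open>auto simp: lin_def\<close>)

lemma solves_ev: "solves H \<Longrightarrow> solves (ev u H)"
proof (induction u arbitrary: H)
  case (DDer u)
  then show ?case unfolding ev.simps ad_def by (auto intro!: solves_diff solves_dw)
qed (simp_all add: solves_letter)

definition evl :: "('x dterm \<Rightarrow>\<^sub>0 'k) \<Rightarrow> (('x mag \<times> nat) list \<Rightarrow> 'v) \<Rightarrow> ('x mag \<times> nat) list \<Rightarrow> 'v" where
  "evl f H w = lext (\<lambda>t. ev t H w) f"

lemma solves_evl:
  assumes "solves H"
  shows "solves (evl f H)"
proof -
  have "solves (\<lambda>w. \<Sum>t\<in>Poly_Mapping.keys f. scale (Poly_Mapping.lookup f t) (ev t H w))"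
    by (intro solves_sum solves_lin[OF lin_scale_op] solves_ev assms)
  moreover have "evl f H = (\<lambda>w. \<Sum>t\<in>Poly_Mapping.keys f. scale (Poly_Mapping.lookup f t) (ev t H w))"
    by (simp add: evl_def lext_def fun_eq_iff)
  ultimately show ?thesis by simp
qed

lemma homog_op_lext:
  assumes F: "homog_op r d F"
  shows "F (\<lambda>w. lext (\<lambda>s. K s w) f) = (\<lambda>w. lext (\<lambda>s. F (K s) w) f)"
proof -
  have "F (\<lambda>w. \<Sum>s\<in>A. scale (c s) (K s w)) = (\<lambda>w. \<Sum>s\<in>A. scale (c s) (F (K s) w))" for A c
    by (induction A rule: infinite_finite_induct)
      (simp_all add: homog_op_zero[OF F] homog_op_add[OF F] homog_op_lin[OF F lin_scale_op])
  then show ?thesis unfolding lext_def .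
qed

lemma dw_lext: "dw (\<lambda>w. lext (\<lambda>s. K s w) f) w = lext (\<lambda>s. dw (K s) w) f"
  by (induction w arbitrary: K) (simp_all add: lext_add_fun)

lemma evl_dmul: "evl (dmul f g) H = evl g (evl f H)"
proof
  fix w
  have "evl (dmul f g) H w = lext (\<lambda>s. lext (\<lambda>t. ev t (ev s H) w) g) f"
    unfolding dmul_def bilin_ext_eq evl_def
    by (simp add: additive_lext[of "lext _"] lext_add lext_lsmult lext_single)
  also have "\<dots> = lext (\<lambda>t. lext (\<lambda>s. ev t (ev s H) w) f) g"
    by (rule lext_swap)
  also have "\<dots> = lext (\<lambda>t. ev t (evl f H) w) g"
  proof (rule lext_cong)
    fix t
    obtain d where d: "homog_op (dpar par t) d (ev t)" using homog_op_ev ..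
    show "lext (\<lambda>s. ev t (ev s H) w) f = ev t (evl f H) w"
      using homog_op_lext[OF d, of "\<lambda>s. ev s H" f] unfolding evl_def[abs_def] by (simp add: fun_eq_iff)
  qed
  finally show "evl (dmul f g) H w = evl g (evl f H) w" unfolding evl_def[of g] .
qed

lemma evl_dder: "evl (dder f) H = (\<lambda>w. evl f (dw H) w - dw (evl f H) w)"
proof
  fix w
  have "evl (dder f) H w = lext (\<lambda>t. ev t (dw H) w - dw (ev t H) w) f"
    unfolding dder_def evl_def
    by (simp add: additive_lext[of "lext _"] lext_add lext_lsmult lext_single ad_def)
  also have "\<dots> = evl f (dw H) w - dw (evl f H) w"
    unfolding lext_diff_fun evl_def[abs_def] dw_lext ..
  finally show "evl (dder f) H w = evl f (dw H) w - dw (evl f H) w" .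
qed

lemma evl_add: "evl (f + g) H = (\<lambda>w. evl f H w + evl g H w)"
  and evl_diff: "evl (f - g) H = (\<lambda>w. evl f H w - evl g H w)"
  and evl_lsmult: "evl (lsmult c f) H = (\<lambda>w. scale c (evl f H w))"
  and evl_zero: "evl 0 H = (\<lambda>w. 0)"
  by (simp_all add: evl_def fun_eq_iff lext_add lext_diff lext_lsmult)

lemma evl_ssign: "evl (ssign a b f) H = (\<lambda>w. sg (a \<and> b) (evl f H w))"
  by (auto simp: ssign_def sg_def evl_def fun_eq_iff lext_uminus)

lemma evl_fun_diff: "evl f (\<lambda>w. H w - G w) = (\<lambda>w. evl f H w - evl f G w)"
proof -
  have "ev t (\<lambda>w. H w - G w) = (\<lambda>w. ev t H w - ev t G w)" for t
    using homog_op_ev[of t] homog_op_diff by blast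
  then show ?thesis by (simp add: evl_def fun_eq_iff lext_diff_fun)
qed

lemma evl_fun_zero: "evl f (\<lambda>w. 0) = (\<lambda>w. 0)"
  using evl_fun_diff[of f "\<lambda>w. 0" "\<lambda>w. 0"] by simp

lemma evl_supercommute:
  assumes H: "supersym q H" and u: "dhom par a u" and v: "dhom par b v"
  shows "evl v (evl u H) = (\<lambda>w. sg (a \<and> b) (evl u (evl v H) w))"
proof
  fix w
  have "evl v (evl u H) w = lext (\<lambda>t. ev t (evl u H) w) v"
    by (simp add: evl_def)
  also have "\<dots> = lext (\<lambda>t. lext (\<lambda>s. ev t (ev s H) w) u) v"
  proof (rule lext_cong)
    fix t
    obtain d where d: "homog_op (dpar par t) d (ev t)" using homog_op_ev ..
    show "ev t (evl u H) w = lext (\<lambda>s. ev t (ev s H) w) u"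
      using homog_op_lext[OF d, of "\<lambda>s. ev s H" u] unfolding evl_def[abs_def] by (simp add: fun_eq_iff)
  qed
  also have "\<dots> = lext (\<lambda>t. lext (\<lambda>s. sg (a \<and> b) (ev s (ev t H) w)) u) v"
  proof (intro lext_cong)
    fix s t assume "t \<in> Poly_Mapping.keys v" "s \<in> Poly_Mapping.keys u"
    then have par: "dpar par s = a" "dpar par t = b" using u v by (auto simp: dhom_def homog_def)
    obtain d where d: "homog_op (dpar par s) d (ev s)" using homog_op_ev ..
    show "ev t (ev s H) w = sg (a \<and> b) (ev s (ev t H) w)"
      using ev_commute[OF d H, of t] par by simp
  qed
  also have "\<dots> = lext (\<lambda>s. lext (\<lambda>t. sg (a \<and> b) (ev s (ev t H) w)) v) u"
    by (rule lext_swap)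
  also have "\<dots> = sg (a \<and> b) (lext (\<lambda>s. ev s (evl v H) w) u)"
    unfolding lin_lext[OF lin_sgn]
  proof (rule lext_cong)
    fix s
    obtain d where d: "homog_op (dpar par s) d (ev s)" using homog_op_ev ..
    show "lext (\<lambda>t. sg (a \<and> b) (ev s (ev t H) w)) v = sg (a \<and> b) (ev s (evl v H) w)"
      using homog_op_lext[OF d, of "\<lambda>t. ev t H" v] unfolding evl_def[abs_def]
      by (simp add: fun_eq_iff lin_lext[OF lin_sgn])
  qed
  finally show "evl v (evl u H) w = sg (a \<and> b) (evl u (evl v H) w)"
    by (simp add: evl_def[of u])
qed

text \<open>By induction a product acts by prepending \<open>s\<close> and then
  \<open>(t, Suc 0)\<close>, and the first kind of relation in \<open>relop\<close> folds these into
  one letter.\<close>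

lemma evl_phi_t: "solves H \<Longrightarrow> evl (phi_t t) H = (\<lambda>w. H ((t, 0) # w))"
proof (induction t arbitrary: H)
  case (MLeaf x)
  show ?case by (simp add: evl_def lext_single fun_eq_iff)
next
  case (MNode s t)
  let ?G = "\<lambda>w. H ((s, 0) # w)"
  have "relop (\<lambda>H w. H ((MNode s t, 0) # w) - H ((s, 0) # (t, Suc 0) # w))"
    unfolding relop_def by blast
  from solves_relop[OF MNode.prems this, of 0]
  have merge: "H ((MNode s t, 0) # w) = H ((s, 0) # (t, Suc 0) # w)" for w
    by (simp add: fun_eq_iff)
  have "evl (phi_t (MNode s t)) H = evl (dder (phi_t t)) ?G"
    by (simp add: evl_dmul MNode.IH(1)[OF MNode.prems])
  also have "\<dots> = (\<lambda>w. dw ?G ((t, 0) # w) - dw (\<lambda>w. ?G ((t, 0) # w)) w)"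
    unfolding evl_dder
    using MNode.IH(2)[OF solves_letter[OF MNode.prems], of "(s, 0)"]
      MNode.IH(2)[OF solves_dw[OF solves_letter[OF MNode.prems]], of "(s, 0)"]
    by (simp del: dw.simps)
  finally show ?case by (simp add: merge)
qed

lemma evl_phi: "solves H \<Longrightarrow> evl (phi f) H w = lext (\<lambda>t. H ((t, 0) # w)) f"
  unfolding phi_def evl_def
  by (simp add: additive_lext[of "lext _"] lext_add lext_lsmult)
    (simp add: evl_def[symmetric] evl_phi_t)

text \<open>The induction covers all solutions \<open>H\<close>, because a left factor
  \<open>a\<close> replaces \<open>H\<close> by \<open>evl a H\<close> and a derivation replaces it
  by \<open>dw H\<close>. The generators from \<open>S\<close> are relations of the second kind in
  \<open>relop\<close>.\<close>

lemma evl_ads_IdD: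
  assumes S: "\<And>s. s \<in> S \<Longrightarrow> (\<exists>i. mhom par i s) \<and> lext e s = 0"
    and g: "g \<in> ads_IdD X par (phi ` S)" and H: "solves H"
  shows "evl g H = (\<lambda>w. 0)"
  using g[unfolded ads_IdD_def] H
proof (induction arbitrary: H)
  case (gen g)
  then consider "g \<in> ads_rel X par" | s where "s \<in> S" "g = phi s" by blast
  then show ?case
  proof cases
    case 1
    then obtain u v w a b where uv: "dhom par a u" "dhom par b v"
      and g: "g = dmul u (dmul v w) - dmul (dmul u v) w
     \<or> g = dmul u v - ssign a b (dmul v u)
     \<or> g = dder (dmul u v) - dmul (dder u) v - dmul u (dder v)"
      unfolding ads_rel_def by blast
    from g show ?thesis
    proof (elim disjE)
      assume "g = dmul u v - ssign a b (dmul v u)"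
      then show ?thesis
        using evl_supercommute[OF solves_sym[OF gen.prems] uv]
        by (simp add: evl_diff evl_ssign evl_dmul)
    qed (simp_all add: evl_diff evl_dmul evl_dder evl_fun_diff)
  next
    case 2
    with S obtain i where "mhom par i s" "lext e s = 0" by blast
    then have "relop (\<lambda>H w. lext (\<lambda>t. H ((t, 0) # w)) s)"
      unfolding relop_def mhom_def homog_def by blast
    from solves_relop[OF gen.prems this, of 0] show ?thesis
      using 2(2) by (simp add: fun_eq_iff evl_phi[OF gen.prems])
  qed
next
  case (oper u d)
  then show ?case by (simp add: evl_dder solves_dw)
qed (simp_all add: evl_zero evl_add evl_lsmult evl_dmul evl_fun_zero solves_evl)

text \<open>The action on \<open>\<Phi>\<close> is evaluated at the empty word: it vanishes by
  membership in the ideal, and it equals \<open>lext e f\<close> because \<open>\<Phi>\<close> sends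
  a one-letter word to its value.\<close>

theorem phi_in_ads_IdD:
  assumes "\<And>s. s \<in> S \<Longrightarrow> (\<exists>i. mhom par i s) \<and> lext e s = 0"
    and "phi f \<in> ads_IdD X par (phi ` S)"
  shows "lext e f = 0"
  using evl_phi[OF solves_\<Phi>, of f "[]"] evl_ads_IdD[OF assms solves_\<Phi>]
  by (simp add: \<Phi>_leaf)

end

subsection \<open>The homomorphism into the differential algebra\<close>

lemma keys_lsmult: "Poly_Mapping.keys (lsmult c f) \<subseteq> Poly_Mapping.keys f"
  by (auto simp: in_keys_iff lookup_lsmult)

lemma keys_lin_ext: "Poly_Mapping.keys (lin_ext h f) \<subseteq> (\<Union>t\<in>Poly_Mapping.keys f. Poly_Mapping.keys (h t))"
proof -
  have "Poly_Mapping.keys (lin_ext h f) \<subseteq> (\<Union>t\<in>Poly_Mapping.keys f. Poly_Mapping.keys (lsmult (Poly_Mapping.lookup f t) (h t)))"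
    unfolding lin_ext_def by (rule Poly_Mapping.keys_sum)
  also have "\<dots> \<subseteq> (\<Union>t\<in>Poly_Mapping.keys f. Poly_Mapping.keys (h t))"
    by (intro UN_mono order_refl keys_lsmult)
  finally show ?thesis .
qed

lemma keys_lin_extE:
  assumes "x \<in> Poly_Mapping.keys (lin_ext h f)"
  obtains t where "t \<in> Poly_Mapping.keys f" "x \<in> Poly_Mapping.keys (h t)"
  using keys_lin_ext[of h f] assms by blast

lemma keys_bilin_extE:
  assumes "x \<in> Poly_Mapping.keys (bilin_ext op f g)"
  obtains s t where "x = op s t" "s \<in> Poly_Mapping.keys f" "t \<in> Poly_Mapping.keys g"
proof -
  from assms obtain s where s: "s \<in> Poly_Mapping.keys f"
    "x \<in> Poly_Mapping.keys (lin_ext (\<lambda>t. Poly_Mapping.single (op s t) (1::'b)) g)"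
    unfolding bilin_ext_eq by (rule keys_lin_extE)
  from s(2) obtain t where "t \<in> Poly_Mapping.keys g" "x \<in> Poly_Mapping.keys (Poly_Mapping.single (op s t) (1::'b))"
    by (rule keys_lin_extE)
  with s(1) that show thesis by simp
qed

lemma bilin_ext_add_left: "bilin_ext op (f + f') g = bilin_ext op f g + bilin_ext op f' g"
  and bilin_ext_add_right: "bilin_ext op f (g + g') = bilin_ext op f g + bilin_ext op f g'"
  and bilin_ext_diff_left: "bilin_ext op (f - f') g = bilin_ext op f g - bilin_ext op f' g"
  and bilin_ext_diff_right: "bilin_ext op f (g - g') = bilin_ext op f g - bilin_ext op f g'"
  and bilin_ext_uminus_left: "bilin_ext op (- f) g = - bilin_ext op f g"
  and bilin_ext_uminus_right: "bilin_ext op f (- g) = - bilin_ext op f g"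
  and bilin_ext_lsmult_left: "bilin_ext op (lsmult c f) g = lsmult c (bilin_ext op f g)"
  and bilin_ext_lsmult_right: "bilin_ext op f (lsmult c g) = lsmult c (bilin_ext op f g)"
  by (simp_all add: bilin_ext_eq lin_ext_eq_lext pm.lext_add pm.lext_add_fun pm.lext_diff pm.lext_diff_fun
      pm.lext_uminus pm.lext_uminus_fun pm.lext_lsmult pm.lext_scale_fun)

lemma bilin_ext_single: "bilin_ext op (Poly_Mapping.single s 1) (Poly_Mapping.single t 1) = Poly_Mapping.single (op s t) 1"
  by (simp add: bilin_ext_eq lin_ext_eq_lext pm.lext_single)

lemmas mmul_linear = bilin_ext_add_left[of MNode, folded mmul_def] bilin_ext_add_right[of MNode, folded mmul_def]
  bilin_ext_diff_left[of MNode, folded mmul_def] bilin_ext_diff_right[of MNode, folded mmul_def]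
  bilin_ext_uminus_left[of MNode, folded mmul_def] bilin_ext_uminus_right[of MNode, folded mmul_def]
  bilin_ext_lsmult_left[of MNode, folded mmul_def] bilin_ext_lsmult_right[of MNode, folded mmul_def]

lemmas dmul_linear = bilin_ext_add_left[of DMul, folded dmul_def] bilin_ext_add_right[of DMul, folded dmul_def]
  bilin_ext_diff_left[of DMul, folded dmul_def] bilin_ext_diff_right[of DMul, folded dmul_def]
  bilin_ext_uminus_left[of DMul, folded dmul_def] bilin_ext_uminus_right[of DMul, folded dmul_def]
  bilin_ext_lsmult_left[of DMul, folded dmul_def] bilin_ext_lsmult_right[of DMul, folded dmul_def]

lemma mmul_single: "mmul (Poly_Mapping.single s 1) (Poly_Mapping.single t 1) = Poly_Mapping.single (MNode s t) 1"
  unfolding mmul_def by (rule bilin_ext_single)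

lemma dder_linear:
  "dder (f + g) = dder f + dder g" "dder (f - g) = dder f - dder g" "dder (- f) = - dder f"
  "dder (lsmult c f) = lsmult c (dder f)"
  by (simp_all add: dder_def lin_ext_eq_lext pm.lext_add pm.lext_diff pm.lext_uminus pm.lext_lsmult)

lemma phi_linear:
  "phi (f + g) = phi f + phi g" "phi (f - g) = phi f - phi g" "phi (- f) = - phi f"
  "phi (lsmult c f) = lsmult c (phi f)" "phi 0 = 0"
  by (simp_all add: phi_def lin_ext_eq_lext pm.lext_add pm.lext_diff pm.lext_uminus pm.lext_lsmult)

lemma phi_single: "phi (Poly_Mapping.single t 1) = phi_t t"
  by (simp add: phi_def lin_ext_eq_lext pm.lext_single)

lemma phi_mmul: "phi (mmul f g) = dmul (phi f) (dder (phi g))"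
proof (rule pm.additive_eqI[of "\<lambda>f. phi (mmul f g)" "\<lambda>f. dmul (phi f) (dder (phi g))"])
  fix s
  show "phi (mmul (Poly_Mapping.single s 1) g) = dmul (phi (Poly_Mapping.single s 1)) (dder (phi g))"
    by (rule pm.additive_eqI[of "\<lambda>g. phi (mmul (Poly_Mapping.single s 1) g)"
          "\<lambda>g. dmul (phi (Poly_Mapping.single s 1)) (dder (phi g))"])
      (simp_all add: mmul_linear dmul_linear phi_linear dder_linear mmul_single phi_single)
qed (simp_all add: mmul_linear dmul_linear phi_linear dder_linear)

lemma homog_bilin_ext:
  assumes "homog r a f" "homog r b g" "\<And>s t. r (op s t) = (r s \<noteq> r t)"
  shows "homog r (a \<noteq> b) (bilin_ext op f g)"
  using assms unfolding homog_def by (auto elim!: keys_bilin_extE)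

lemma homog_lin_ext:
  assumes "\<And>t. t \<in> Poly_Mapping.keys f \<Longrightarrow> homog r i (h t)"
  shows "homog r i (lin_ext h f)"
  using assms unfolding homog_def by (blast elim: keys_lin_extE)

lemma mhom_mmul: "mhom par a f \<Longrightarrow> mhom par b g \<Longrightarrow> mhom par (a \<noteq> b) (mmul f g)"
  unfolding mhom_def mmul_def by (rule homog_bilin_ext) simp_all

lemma dhom_dmul: "dhom par a f \<Longrightarrow> dhom par b g \<Longrightarrow> dhom par (a \<noteq> b) (dmul f g)"
  unfolding dhom_def dmul_def by (rule homog_bilin_ext) simp_all

lemma dhom_dder: "dhom par a f \<Longrightarrow> dhom par a (dder f)"
  unfolding dhom_def dder_def by (rule homog_lin_ext) (simp add: homog_def)

lemma dhom_phi_t: "dhom par (mpar par t) (phi_t t)"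
proof (induction t)
  case (MLeaf x)
  show ?case by (simp add: dhom_def homog_def)
next
  case (MNode s t)
  then show ?case unfolding phi_t.simps mpar.simps by (intro dhom_dmul dhom_dder)
qed

lemma dhom_phi: "mhom par i f \<Longrightarrow> dhom par i (phi f)"
  unfolding dhom_def mhom_def phi_def
  by (rule homog_lin_ext) (use dhom_phi_t[of par] in \<open>auto simp: homog_def dhom_def\<close>)

lemma dterm_alg_dmul: "f \<in> dterm_alg X \<Longrightarrow> g \<in> dterm_alg X \<Longrightarrow> dmul f g \<in> dterm_alg X"
  unfolding dterm_alg_def dmul_def by (fastforce elim!: keys_bilin_extE)

lemma dterm_alg_lin_ext:
  assumes "\<And>t. t \<in> Poly_Mapping.keys f \<Longrightarrow> h t \<in> dterm_alg X"
  shows "lin_ext h f \<in> dterm_alg X"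
  using assms unfolding dterm_alg_def by (blast elim: keys_lin_extE)

lemma dterm_alg_dder: "f \<in> dterm_alg X \<Longrightarrow> dder f \<in> dterm_alg X"
  unfolding dder_def by (rule dterm_alg_lin_ext) (simp add: dterm_alg_def)

lemma dterm_alg_phi_t: "set_mag t \<subseteq> X \<Longrightarrow> phi_t t \<in> dterm_alg X"
proof (induction t)
  case (MLeaf x)
  then show ?case by (simp add: dterm_alg_def)
qed (simp add: dterm_alg_dmul dterm_alg_dder)

lemma dterm_alg_phi: "f \<in> mag_alg X \<Longrightarrow> phi f \<in> dterm_alg X"
  unfolding phi_def by (intro dterm_alg_lin_ext dterm_alg_phi_t) (simp add: mag_alg_def)

section \<open>Images of GDN relations in the differential ideal\<close>

lemma gen_ideal_uminus: "u \<in> gen_ideal mul ops C G \<Longrightarrow> - u \<in> gen_ideal mul ops C G"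
proof -
  assume "u \<in> gen_ideal mul ops C G"
  then have "lsmult (- 1) u \<in> gen_ideal mul ops C G" by (rule gen_ideal.smult)
  then show ?thesis by simp
qed

lemma gen_ideal_diff:
  "u \<in> gen_ideal mul ops C G \<Longrightarrow> v \<in> gen_ideal mul ops C G \<Longrightarrow> u - v \<in> gen_ideal mul ops C G"
  using gen_ideal.add[of u mul ops C G "- v"] gen_ideal_uminus[of v] by simp

lemma gen_ideal_sg: "u \<in> gen_ideal mul ops C G \<Longrightarrow> sg b u \<in> gen_ideal mul ops C G"
  by (simp add: sg_def gen_ideal_uminus)

lemma ssign_eq_sg: "ssign a b f = sg (a \<and> b) f"
  by (auto simp: ssign_def sg_def)

context
  fixes X :: "'x set" and par :: "'x \<Rightarrow> bool" and T :: "('x dterm \<Rightarrow>\<^sub>0 'k::field) set"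
begin

lemma ads_assoc:
  assumes "u \<in> dterm_alg X" "v \<in> dterm_alg X" "w \<in> dterm_alg X" "dhom par a u" "dhom par b v"
  shows "dmul u (dmul v w) - dmul (dmul u v) w \<in> ads_IdD X par T"
  unfolding ads_IdD_def ads_rel_def using assms by (intro gen_ideal.gen) blast

lemma ads_comm:
  assumes "u \<in> dterm_alg X" "v \<in> dterm_alg X" "dhom par a u" "dhom par b v"
  shows "dmul u v - sg (a \<and> b) (dmul v u) \<in> ads_IdD X par T"
  unfolding ads_IdD_def ads_rel_def ssign_eq_sg using assms by (intro gen_ideal.gen) blast

lemma ads_deriv:
  assumes "u \<in> dterm_alg X" "v \<in> dterm_alg X" "dhom par a u" "dhom par b v"
  shows "dder (dmul u v) - dmul (dder u) v - dmul u (dder v) \<in> ads_IdD X par T"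
  unfolding ads_IdD_def ads_rel_def using assms by (intro gen_ideal.gen) blast

lemma ads_lmul: "u \<in> ads_IdD X par T \<Longrightarrow> a \<in> dterm_alg X \<Longrightarrow> dmul a u \<in> ads_IdD X par T"
  and ads_rmul: "u \<in> ads_IdD X par T \<Longrightarrow> a \<in> dterm_alg X \<Longrightarrow> dmul u a \<in> ads_IdD X par T"
  and ads_dder: "u \<in> ads_IdD X par T \<Longrightarrow> dder u \<in> ads_IdD X par T"
  and ads_add: "u \<in> ads_IdD X par T \<Longrightarrow> v \<in> ads_IdD X par T \<Longrightarrow> u + v \<in> ads_IdD X par T"
  and ads_diff: "u \<in> ads_IdD X par T \<Longrightarrow> v \<in> ads_IdD X par T \<Longrightarrow> u - v \<in> ads_IdD X par T"
  and ads_sg: "u \<in> ads_IdD X par T \<Longrightarrow> sg b u \<in> ads_IdD X par T"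
  unfolding ads_IdD_def
  by (blast intro: gen_ideal.lmul gen_ideal.rmul gen_ideal.oper gen_ideal.add gen_ideal_diff gen_ideal_sg)+

text \<open>Modulo associativity and the Leibniz rule, \<open>u D(v Dw) - (u Dv) Dw\<close> is
  \<open>u v DDw\<close>, which is supersymmetric in \<open>u\<close> and \<open>v\<close>; likewise
  \<open>(u Dv) Dw\<close> is supersymmetric in the two derivatives.\<close>

lemma phi_gdn_rel:
  assumes "r \<in> gdn_rel X par"
  shows "phi r \<in> ads_IdD X par T"
proof -
  from assms obtain x y z a b c where
    C: "x \<in> mag_alg X" "y \<in> mag_alg X" "z \<in> mag_alg X"
    and H: "mhom par a x" "mhom par b y" "mhom par c z"
    and r: "r = mmul x (mmul y z) - mmul (mmul x y) z
            - ssign a b (mmul y (mmul x z) - mmul (mmul y x) z)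
     \<or> r = mmul (mmul x y) z - ssign b c (mmul (mmul x z) y)"
    unfolding gdn_rel_def by blast
  define u v w where "u = phi x" and "v = phi y" and "w = phi z"
  have uvw: "u \<in> dterm_alg X" "v \<in> dterm_alg X" "w \<in> dterm_alg X" "dhom par a u" "dhom par b v" "dhom par c w"
    using C H by (simp_all add: u_def v_def w_def dterm_alg_phi dhom_phi)
  note uvw' = uvw uvw(1-3)[THEN dterm_alg_dder] uvw(4-6)[THEN dhom_dder]
    uvw(1-3)[THEN dterm_alg_dder, THEN dterm_alg_dder]
  \<comment> \<open>\<open>A\<close> is the associator and \<open>E\<close> the defect of the
    Leibniz rule; the image of each GDN relator is written through these and
    supercommutators.\<close>
  define A where "A = (\<lambda>p q r :: 'x dterm \<Rightarrow>\<^sub>0 'k. dmul p (dmul q r) - dmul (dmul p q) r)"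
  define E where "E = (\<lambda>p q :: 'x dterm \<Rightarrow>\<^sub>0 'k. dder (dmul p q) - dmul (dder p) q - dmul p (dder q))"
  have A: "A u (dder v) (dder w) \<in> ads_IdD X par T" "A u v (dder (dder w)) \<in> ads_IdD X par T"
    "A v (dder u) (dder w) \<in> ads_IdD X par T" "A v u (dder (dder w)) \<in> ads_IdD X par T"
    "A u (dder w) (dder v) \<in> ads_IdD X par T"
    unfolding A_def using uvw' by (blast intro: ads_assoc)+
  have E: "dmul u (E v (dder w)) \<in> ads_IdD X par T" "dmul v (E u (dder w)) \<in> ads_IdD X par T"
    unfolding E_def using uvw' by (blast intro: ads_deriv ads_lmul)+
  have C1: "dmul (dmul u v - sg (a \<and> b) (dmul v u)) (dder (dder w)) \<in> ads_IdD X par T"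
    and C2: "dmul u (dmul (dder v) (dder w) - sg (b \<and> c) (dmul (dder w) (dder v))) \<in> ads_IdD X par T"
    using uvw' by (blast intro: ads_comm ads_lmul ads_rmul)+
  from r show ?thesis
  proof
    assume r: "r = mmul x (mmul y z) - mmul (mmul x y) z
            - ssign a b (mmul y (mmul x z) - mmul (mmul y x) z)"
    have "phi r = (dmul u (E v (dder w)) + A u (dder v) (dder w) + A u v (dder (dder w)))
        - sg (a \<and> b) (dmul v (E u (dder w)) + A v (dder u) (dder w) + A v u (dder (dder w)))
        + dmul (dmul u v - sg (a \<and> b) (dmul v u)) (dder (dder w))"
      unfolding r ssign_eq_sg A_def E_def
      by (cases "a \<and> b")
        (auto simp: sg_def phi_linear phi_mmul u_def v_def w_def dmul_linear algebra_simps)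
    also have "\<dots> \<in> ads_IdD X par T"
      by (intro ads_add ads_diff ads_sg A E C1)
    finally show ?thesis .
  next
    assume r: "r = mmul (mmul x y) z - ssign b c (mmul (mmul x z) y)"
    have "phi r = dmul u (dmul (dder v) (dder w) - sg (b \<and> c) (dmul (dder w) (dder v)))
        + sg (b \<and> c) (A u (dder w) (dder v)) - A u (dder v) (dder w)"
      unfolding r ssign_eq_sg A_def
      by (cases "b \<and> c")
        (auto simp: sg_def phi_linear phi_mmul u_def v_def w_def dmul_linear algebra_simps)
    also have "\<dots> \<in> ads_IdD X par T"
      by (intro ads_add ads_diff ads_sg A C2)
    finally show ?thesis .
  qed
qed

end

text \<open>Left multiplication needs closure of the target ideal under \<open>D\<close>, since
  \<open>a \<circ> u\<close> becomes \<open>a D(u)\<close>.\<close>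

lemma phi_gdn_Id:
  assumes "f \<in> gdn_Id X par S"
  shows "phi f \<in> ads_IdD X par (phi ` S)"
  using assms unfolding gdn_Id_def
proof (induction rule: gen_ideal.induct)
  case (gen g)
  then show ?case
    using phi_gdn_rel[of g X par "phi ` S"] by (auto simp: ads_IdD_def intro: gen_ideal.gen)
next
  case (smult u c)
  then show ?case by (simp add: phi_linear ads_IdD_def gen_ideal.smult)
next
  case zero
  show ?case by (simp add: phi_linear ads_IdD_def gen_ideal.zero)
qed (simp_all add: phi_linear phi_mmul ads_add ads_lmul ads_rmul ads_dder dterm_alg_phi dterm_alg_dder)

text \<open>The quotient by \<open>J\<close> is realized inside the space itself, as the image of a
  projection onto a complement along \<open>J\<close>, obtained by extending a basis of
  \<open>J\<close>.\<close>

lemma (in vector_space) projection_exists: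
  assumes J: "subspace J"
  obtains P where "\<And>f g. P (f + g) = P f + P g" "\<And>c f. P (scale c f) = scale c (P f)"
    "\<And>f. P f = 0 \<longleftrightarrow> f \<in> J" "\<And>f. P f - f \<in> J"
proof -
  interpret vp: vector_space_pair scale scale by unfold_locales
  obtain B where B: "B \<subseteq> J" "independent B" "J \<subseteq> span B"
    using maximal_independent_subset by blast
  have spanB: "span B = J"
    using B span_minimal[OF B(1) J] by blast
  define E where "E = extend_basis B"
  have E: "independent E" "span E = UNIV" "B \<subseteq> E"
    unfolding E_def by (auto simp: independent_extend_basis B span_extend_basis extend_basis_superset)
  define P where "P = vp.construct E (\<lambda>b. if b \<in> B then 0 else b)"
  have P: "Vector_Spaces.linear scale scale P"
    unfolding P_def by (rule vp.linear_construct[OF E(1)])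
  have base: "P b = (if b \<in> B then 0 else b)" if "b \<in> E" for b
    unfolding P_def by (rule vp.construct_basis[OF E(1) that])
  have diff: "P f - f \<in> J" for f
  proof -
    have "f \<in> span E" using E by simp
    then show ?thesis
    proof (induction rule: span_induct)
      case base
      show ?case
      proof (rule subspaceI)
        show "0 \<in> {f. P f - f \<in> J}" by (simp add: vp.linear_0[OF P] subspace_0[OF J])
      next
        fix x y assume "x \<in> {f. P f - f \<in> J}" "y \<in> {f. P f - f \<in> J}"
        then have "(P x - x) + (P y - y) \<in> J" by (intro subspace_add[OF J]) auto
        then show "x + y \<in> {f. P f - f \<in> J}" by (simp add: vp.linear_add[OF P] algebra_simps)
      next
        fix c x assume "x \<in> {f. P f - f \<in> J}"
        then show "scale c x \<in> {f. P f - f \<in> J}"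
          using subspace_scale[OF J, of "P x - x" c] by (simp add: vp.linear_scale[OF P] scale_right_diff_distrib)
      qed
    next
      case (step b)
      then show ?case
        using base[OF step] B(1) subspace_0[OF J] subspace_neg[OF J] by (auto split: if_splits)
    qed
  qed
  have "P f = 0" if "f \<in> J" for f
  proof (rule vp.linear_eq_0_on_span[OF P])
    show "f \<in> span B" using that spanB by simp
    show "P b = 0" if "b \<in> B" for b using base[of b] E(3) that by auto
  qed
  moreover have "f \<in> J" if "P f = 0" for f
    using diff[of f] that subspace_neg[OF J, of "- f"] by simp
  ultimately show thesis
    using that[of P] vp.linear_add[OF P] vp.linear_scale[OF P] diff by blast
qed

subsection \<open>The quotient and its operators\<close>

abbreviation sing :: "'t \<Rightarrow> 't \<Rightarrow>\<^sub>0 'k::field" where "sing t \<equiv> Poly_Mapping.single t 1"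

lemma linear_eqI:
  fixes T U :: "('t \<Rightarrow>\<^sub>0 'k::field) \<Rightarrow> ('u \<Rightarrow>\<^sub>0 'k)"
  assumes "\<And>f g. T (f + g) = T f + T g" "\<And>c f. T (lsmult c f) = lsmult c (T f)"
    and "\<And>f g. U (f + g) = U f + U g" "\<And>c f. U (lsmult c f) = lsmult c (U f)"
    and "\<And>t. T (sing t) = U (sing t)"
  shows "T f = U f"
  using assms by (rule pm.additive_eqI)

text \<open>The parity automorphism; it makes the sign in \<open>\<rho> a f\<close> linear in
  \<open>f\<close>, also for inhomogeneous \<open>f\<close>.\<close>

definition twist :: "('x \<Rightarrow> bool) \<Rightarrow> bool \<Rightarrow> ('x mag \<Rightarrow>\<^sub>0 'k::field) \<Rightarrow> ('x mag \<Rightarrow>\<^sub>0 'k)" where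
  "twist par b = lin_ext (\<lambda>t. sg (b \<and> mpar par t) (sing t))"

text \<open>\<open>gdn_Id X par S\<close> is an ideal of \<open>mag_alg X\<close> only. Killing the trees that leave \<open>X\<close> extends it to an ideal
  of the whole magma algebra.\<close>

definition restr :: "'x set \<Rightarrow> ('x mag \<Rightarrow>\<^sub>0 'k::field) \<Rightarrow> ('x mag \<Rightarrow>\<^sub>0 'k)" where
  "restr X = lin_ext (\<lambda>t. if set_mag t \<subseteq> X then sing t else 0)"

lemma twist_linear:
  "twist par b (f + g) = twist par b f + twist par b g" "twist par b (lsmult c f) = lsmult c (twist par b f)"
  "twist par b 0 = 0"
  and restr_linear: "restr X (f + g) = restr X f + restr X g" "restr X (lsmult c f) = lsmult c (restr X f)"
  "restr X 0 = 0" "restr X (f - g) = restr X f - restr X g" "restr X (- f) = - restr X f"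
  by (simp_all add: twist_def restr_def lin_ext_eq_lext pm.lext_add pm.lext_lsmult pm.lext_diff pm.lext_uminus)

lemma twist_single: "twist par b (sing t) = sg (b \<and> mpar par t) (sing t)"
  and restr_single: "restr X (sing t) = (if set_mag t \<subseteq> X then sing t else 0)"
  by (simp_all add: twist_def restr_def lin_ext_eq_lext pm.lext_single)

lemma sg_linear: "sg b (lsmult c f) = lsmult c (sg b f)"
  by (simp add: sg_def)

lemma mmul_0: "mmul 0 f = 0" "mmul f 0 = 0"
  using mmul_linear(3)[of f f f] mmul_linear(4)[of f f f] by simp_all

lemma mmul_sg: "mmul (sg b f) g = sg b (mmul f g)" "mmul f (sg b g) = sg b (mmul f g)"
  by (simp_all add: sg_def mmul_linear)

lemma restr_sg: "restr X (sg b f) = sg b (restr X f)"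
  by (simp add: sg_def restr_linear)

lemma twist_mmul: "twist par b (mmul f g) = mmul (twist par b f) (twist par b g)"
proof (rule linear_eqI[of "\<lambda>f. twist par b (mmul f g)" "\<lambda>f. mmul (twist par b f) (twist par b g)"])
  fix s
  show "twist par b (mmul (sing s) g) = mmul (twist par b (sing s)) (twist par b g)"
  proof (rule linear_eqI[of "\<lambda>g. twist par b (mmul (sing s) g)" "\<lambda>g. mmul (twist par b (sing s)) (twist par b g)"])
    fix t
    show "twist par b (mmul (sing s) (sing t)) = mmul (twist par b (sing s)) (twist par b (sing t))"
      by (simp add: mmul_single twist_single mmul_sg) (rule sg_cong, auto)
  qed (simp_all add: mmul_linear twist_linear)
qed (simp_all add: mmul_linear twist_linear)

lemma restr_mmul: "restr X (mmul f g) = mmul (restr X f) (restr X g)"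
proof (rule linear_eqI[of "\<lambda>f. restr X (mmul f g)" "\<lambda>f. mmul (restr X f) (restr X g)"])
  fix s
  show "restr X (mmul (sing s) g) = mmul (restr X (sing s)) (restr X g)"
  proof (rule linear_eqI[of "\<lambda>g. restr X (mmul (sing s) g)" "\<lambda>g. mmul (restr X (sing s)) (restr X g)"])
    fix t
    show "restr X (mmul (sing s) (sing t)) = mmul (restr X (sing s)) (restr X (sing t))"
      by (simp add: mmul_single restr_single mmul_0)
  qed (simp_all add: mmul_linear restr_linear)
qed (simp_all add: mmul_linear restr_linear)

lemma restr_twist: "restr X (twist par b f) = twist par b (restr X f)"
  by (rule linear_eqI[of "\<lambda>f. restr X (twist par b f)" "\<lambda>f. twist par b (restr X f)"])
    (simp_all add: restr_linear twist_linear twist_single restr_single restr_sg)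

lemma twist_homog: "mhom par i f \<Longrightarrow> twist par b f = sg (b \<and> i) f"
proof -
  assume "mhom par i f"
  then have "twist par b f = pm.lext (\<lambda>t. sg (b \<and> i) (sing t)) f"
    unfolding twist_def lin_ext_eq_lext mhom_def homog_def by (intro pm.lext_cong) simp
  also have "\<dots> = sg (b \<and> i) (pm.lext sing f)"
    by (cases "b \<and> i") (auto simp: sg_def pm.lext_uminus_fun)
  also have "pm.lext sing f = f"
    using lin_ext_single_id[of f] by (simp add: lin_ext_eq_lext)
  finally show ?thesis .
qed

lemma restr_id: "f \<in> mag_alg X \<Longrightarrow> restr X f = f"
proof -
  assume "f \<in> mag_alg X"
  then have "restr X f = lin_ext sing f"
    unfolding restr_def lin_ext_eq_lext mag_alg_def by (intro pm.lext_cong) simp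
  then show ?thesis by (simp add: lin_ext_single_id)
qed

lemma mag_alg_lin_ext:
  assumes "\<And>t. t \<in> Poly_Mapping.keys f \<Longrightarrow> h t \<in> mag_alg X"
  shows "lin_ext h f \<in> mag_alg X"
  using assms unfolding mag_alg_def by (blast elim: keys_lin_extE)

lemma restr_mag_alg: "restr X f \<in> mag_alg X"
  unfolding restr_def by (rule mag_alg_lin_ext) (simp add: mag_alg_def)

lemma twist_mag_alg: "f \<in> mag_alg X \<Longrightarrow> twist par b f \<in> mag_alg X"
  unfolding twist_def by (rule mag_alg_lin_ext) (auto simp: mag_alg_def sg_def)

lemma homog_diff: "homog r i f \<Longrightarrow> homog r i g \<Longrightarrow> homog r i (f - g)"
  and homog_sg: "homog r i f \<Longrightarrow> homog r i (sg b f)"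
  for f g :: "'t \<Rightarrow>\<^sub>0 'k::field"
  unfolding homog_def by (auto simp: in_keys_iff lookup_minus sg_def)

lemma mhom_gdn_rel:
  assumes "r \<in> gdn_rel X par"
  shows "\<exists>i. mhom par i r"
proof -
  from assms obtain x y z a b c where H: "mhom par a x" "mhom par b y" "mhom par c z"
    and r: "r = mmul x (mmul y z) - mmul (mmul x y) z
            - ssign a b (mmul y (mmul x z) - mmul (mmul y x) z)
     \<or> r = mmul (mmul x y) z - ssign b c (mmul (mmul x z) y)"
    unfolding gdn_rel_def by blast
  let ?i = "a \<noteq> (b \<noteq> c)"
  have i: "((a \<noteq> b) \<noteq> c) = ?i" "(b \<noteq> (a \<noteq> c)) = ?i" "((b \<noteq> a) \<noteq> c) = ?i" "((a \<noteq> c) \<noteq> b) = ?i"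
    by auto
  have m: "mhom par ?i (mmul x (mmul y z))" "mhom par ?i (mmul (mmul x y) z)"
    "mhom par ?i (mmul y (mmul x z))" "mhom par ?i (mmul (mmul y x) z)" "mhom par ?i (mmul (mmul x z) y)"
    using mhom_mmul[OF H(1) mhom_mmul[OF H(2,3)]] mhom_mmul[OF mhom_mmul[OF H(1,2)] H(3)]
      mhom_mmul[OF H(2) mhom_mmul[OF H(1,3)]] mhom_mmul[OF mhom_mmul[OF H(2,1)] H(3)]
      mhom_mmul[OF mhom_mmul[OF H(1,3)] H(2)] unfolding i by blast+
  have "mhom par ?i r"
    using r m unfolding mhom_def ssign_eq_sg by (auto simp del: sg_simps intro!: homog_diff homog_sg)
  then show ?thesis ..
qed

context
  fixes X :: "'x set" and par :: "'x \<Rightarrow> bool" and S :: "('x mag \<Rightarrow>\<^sub>0 'k::field) set"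
  assumes S_homog: "\<forall>s\<in>S. \<exists>i. mhom par i s"
begin

abbreviation (input) I where "I \<equiv> gdn_Id X par S"

text \<open>All generators are homogeneous, so \<open>twist\<close> only changes their sign; being
  multiplicative, it then preserves the ideal.\<close>

lemma twist_I: "f \<in> I \<Longrightarrow> twist par b f \<in> I"
proof -
  assume "f \<in> I"
  then show ?thesis unfolding gdn_Id_def
  proof (induction rule: gen_ideal.induct)
    case (gen g)
    then obtain i where "mhom par i g" using mhom_gdn_rel[of g X par] S_homog by blast
    then show ?case using gen by (auto simp: twist_homog intro: gen_ideal_sg gen_ideal.gen)
  qed (auto simp: twist_linear twist_mmul intro: gen_ideal.zero gen_ideal.add gen_ideal.smult
      gen_ideal.lmul gen_ideal.rmul twist_mag_alg)
qed

definition quot_ker :: "('x mag \<Rightarrow>\<^sub>0 'k) set" where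
  "quot_ker = {f. restr X f \<in> I}"

lemma quot_ker_0: "0 \<in> quot_ker"
  and quot_ker_add: "f \<in> quot_ker \<Longrightarrow> g \<in> quot_ker \<Longrightarrow> f + g \<in> quot_ker"
  and quot_ker_diff: "f \<in> quot_ker \<Longrightarrow> g \<in> quot_ker \<Longrightarrow> f - g \<in> quot_ker"
  and quot_ker_lsmult: "f \<in> quot_ker \<Longrightarrow> lsmult c f \<in> quot_ker"
  and quot_ker_sg: "f \<in> quot_ker \<Longrightarrow> sg b f \<in> quot_ker"
  and quot_ker_twist: "f \<in> quot_ker \<Longrightarrow> twist par b f \<in> quot_ker"
  and quot_ker_lmul: "f \<in> quot_ker \<Longrightarrow> mmul g f \<in> quot_ker"
  and quot_ker_rmul: "f \<in> quot_ker \<Longrightarrow> mmul f g \<in> quot_ker"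
  unfolding quot_ker_def
  by (auto simp: restr_linear restr_sg restr_twist restr_mmul gdn_Id_def gen_ideal_sg
      twist_I[unfolded gdn_Id_def]
      intro: gen_ideal.zero gen_ideal.add gen_ideal.smult gen_ideal_diff
      gen_ideal.lmul[OF _ restr_mag_alg] gen_ideal.rmul[OF _ restr_mag_alg])

text \<open>With all leaves in \<open>X\<close> this is a relator; otherwise every tree in it leaves
  \<open>X\<close>, and \<open>restr\<close> kills it.\<close>

lemma quot_ker_lsym:
  "sing (MNode x (MNode y z)) - sing (MNode (MNode x y) z)
    - sg (mpar par x \<and> mpar par y) (sing (MNode y (MNode x z)) - sing (MNode (MNode y x) z)) \<in> quot_ker" (is "?r \<in> quot_ker")
proof (cases "set_mag x \<subseteq> X \<and> set_mag y \<subseteq> X \<and> set_mag z \<subseteq> X")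
  case True
  have "\<exists>x' y' z' a b c.
      x' \<in> mag_alg X \<and> y' \<in> mag_alg X \<and> z' \<in> mag_alg X \<and>
      mhom par a x' \<and> mhom par b y' \<and> mhom par c z' \<and>
      ?r = mmul x' (mmul y' z') - mmul (mmul x' y') z' - ssign a b (mmul y' (mmul x' z') - mmul (mmul y' x') z')"
    using True
    by (intro exI[of _ "sing x"] exI[of _ "sing y"] exI[of _ "sing z"]
        exI[of _ "mpar par x"] exI[of _ "mpar par y"] exI[of _ "mpar par z"])
      (simp add: mag_alg_def mhom_def homog_def mmul_single ssign_eq_sg)
  then have "?r \<in> gdn_rel X par" unfolding gdn_rel_def by blast
  then have "?r \<in> I" unfolding gdn_Id_def by (intro gen_ideal.gen) simp
  moreover have "restr X ?r = ?r"
    using True by (simp add: restr_linear restr_sg restr_single)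
  ultimately show ?thesis by (simp add: quot_ker_def)
next
  case False
  then have "restr X ?r = 0"
    by (auto simp: restr_linear restr_sg restr_single)
  then show ?thesis by (simp add: quot_ker_def gdn_Id_def gen_ideal.zero)
qed

lemma quot_ker_rcomm:
  "sing (MNode (MNode x y) z) - sg (mpar par y \<and> mpar par z) (sing (MNode (MNode x z) y)) \<in> quot_ker" (is "?r \<in> quot_ker")
proof (cases "set_mag x \<subseteq> X \<and> set_mag y \<subseteq> X \<and> set_mag z \<subseteq> X")
  case True
  have "\<exists>x' y' z' a b c.
      x' \<in> mag_alg X \<and> y' \<in> mag_alg X \<and> z' \<in> mag_alg X \<and>
      mhom par a x' \<and> mhom par b y' \<and> mhom par c z' \<and>
      ?r = mmul (mmul x' y') z' - ssign b c (mmul (mmul x' z') y')"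
    using True
    by (intro exI[of _ "sing x"] exI[of _ "sing y"] exI[of _ "sing z"]
        exI[of _ "mpar par x"] exI[of _ "mpar par y"] exI[of _ "mpar par z"])
      (simp add: mag_alg_def mhom_def homog_def mmul_single ssign_eq_sg)
  then have "?r \<in> gdn_rel X par" unfolding gdn_rel_def by blast
  then have "?r \<in> I" unfolding gdn_Id_def by (intro gen_ideal.gen) simp
  moreover have "restr X ?r = ?r"
    using True by (simp add: restr_linear restr_sg restr_single)
  ultimately show ?thesis by (simp add: quot_ker_def)
next
  case False
  then have "restr X ?r = 0"
    by (auto simp: restr_linear restr_sg restr_single)
  then show ?thesis by (simp add: quot_ker_def gdn_Id_def gen_ideal.zero)
qed

lemma quotient_operators:
  obtains P where "\<And>f. P f = 0 \<longleftrightarrow> f \<in> quot_ker"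
    "gdn_operators lsmult par (\<lambda>t. P (sing t)) (\<lambda>y f. P (mmul (sing y) f))
       (\<lambda>a f. P (mmul (twist par (mpar par a) f) (sing a)))"
    "\<And>f. pm.lext (\<lambda>t. P (sing t)) f = P f"
proof -
  have "pm.subspace quot_ker"
    by (rule pm.subspaceI) (auto intro: quot_ker_0 quot_ker_add quot_ker_lsmult)
  then obtain P where P: "\<And>f g. P (f + g) = P f + P g" "\<And>c f. P (lsmult c f) = lsmult c (P f)"
    "\<And>f. P f = 0 \<longleftrightarrow> f \<in> quot_ker" "\<And>f. P f - f \<in> quot_ker"
    by (rule pm.projection_exists) blast
  have P_diff: "P (f - g) = P f - P g" for f g
    using P(1)[of "f - g" g] by (simp add: algebra_simps)
  have P_uminus: "P (- f) = - P f" for f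
    using P_diff[of 0 f] P_diff[of 0 0] by simp
  have P_sg: "P (sg b f) = sg b (P f)" for b f
    by (simp add: sg_def P_uminus)
  have P_eq: "P f = P g \<longleftrightarrow> f - g \<in> quot_ker" for f g
    using P(3)[of "f - g"] by (simp add: P_diff)
  have twist_diff: "twist par b (f - g) = twist par b f - twist par b g" for b and f g :: "'x mag \<Rightarrow>\<^sub>0 'k"
    using twist_linear(1)[of par b "f - g" g] by (simp add: algebra_simps)
  define l where "l = (\<lambda>y f :: 'x mag \<Rightarrow>\<^sub>0 'k. mmul (sing y) f)"
  define r where "r = (\<lambda>a f :: 'x mag \<Rightarrow>\<^sub>0 'k. mmul (twist par (mpar par a) f) (sing a))"
  have Pl: "P (l y (P f)) = P (l y f)" for y f
    unfolding P_eq l_def mmul_linear(4)[symmetric] by (rule quot_ker_lmul[OF P(4)])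
  have Pr: "P (r a (P f)) = P (r a f)" for a f
    unfolding P_eq r_def mmul_linear(3)[symmetric] twist_diff[symmetric] by (rule quot_ker_rmul[OF quot_ker_twist[OF P(4)]])
  have l_linear: "l y (f + g) = l y f + l y g" "l y (lsmult c f) = lsmult c (l y f)"
    "l y (sg b f) = sg b (l y f)" for y f g c b
    by (simp_all add: l_def mmul_linear mmul_sg)
  have r_linear: "r y (f + g) = r y f + r y g" "r y (lsmult c f) = lsmult c (r y f)"
    "r y (sg b f) = sg b (r y f)" for y f g c b
    using twist_diff[of _ 0 f]
    by (simp_all add: r_def mmul_linear mmul_sg twist_linear sg_def)
  have l_single: "l y (sing x) = sing (MNode y x)" for y x
    by (simp add: l_def mmul_single)
  have r_single: "r a (sing x) = sg (mpar par a \<and> mpar par x) (sing (MNode x a))" for a x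
    by (simp add: r_def twist_single mmul_sg mmul_single)
  \<comment> \<open>Membership of a linear expression is checked on single trees, where
    \<open>quot_ker_lsym\<close> and \<open>quot_ker_rcomm\<close> apply.\<close>
  have in_quot_ker: "U f \<in> quot_ker" if "\<And>f g. U (f + g) = U f + U g" "\<And>c f. U (lsmult c f) = lsmult c (U f)"
    "\<And>x. U (sing x) \<in> quot_ker" for U :: "('x mag \<Rightarrow>\<^sub>0 'k) \<Rightarrow> 'x mag \<Rightarrow>\<^sub>0 'k" and f
  proof -
    have "P (U f) = 0"
      by (rule linear_eqI[of "\<lambda>f. P (U f)" "\<lambda>f. 0"]) (use that P in simp_all)
    then show ?thesis by (simp add: P)
  qed
  have "gdn_operators lsmult par (\<lambda>t. P (sing t)) (\<lambda>y f. P (l y f)) (\<lambda>a f. P (r a f))"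
  proof
    fix y f g c
    show "P (l y (f + g)) = P (l y f) + P (l y g)" "P (l y (lsmult c f)) = lsmult c (P (l y f))"
      "P (r y (f + g)) = P (r y f) + P (r y g)" "P (r y (lsmult c f)) = lsmult c (P (r y f))"
      by (simp_all add: l_linear r_linear P)
  next
    fix y z
    show "P (l y (P (sing z))) = P (sing (MNode y z))"
      unfolding Pl l_single ..
  next
    fix a y
    show "P (r a (P (sing y))) = sg (mpar par a \<and> mpar par y) (P (sing (MNode y a)))"
      unfolding Pr r_single P_sg ..
  next
    fix y a f
    have "l y (r a f) - sg (mpar par y \<and> mpar par a) (r a (l y f)) - (r (MNode y a) f - r y (r a f)) \<in> quot_ker"
    proof (rule in_quot_ker[of "\<lambda>f. l y (r a f) - sg (mpar par y \<and> mpar par a) (r a (l y f)) - (r (MNode y a) f - r y (r a f))"])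
      fix x
      let ?s = "mpar par y \<and> mpar par x"
      \<comment> \<open>Left-symmetry for \<open>y\<close>, \<open>x\<close>, \<open>a\<close>,
        followed by the second GDN identity, which turns \<open>(x y) a\<close> into
        \<open>(x a) y\<close>.\<close>
      have "sg (mpar par a \<and> mpar par x) ((sing (MNode y (MNode x a)) - sing (MNode (MNode y x) a)
          - sg ?s (sing (MNode x (MNode y a)) - sing (MNode (MNode x y) a)))
        - sg ?s (sing (MNode (MNode x y) a) - sg (mpar par y \<and> mpar par a) (sing (MNode (MNode x a) y)))) \<in> quot_ker"
        by (intro quot_ker_sg quot_ker_diff[OF quot_ker_lsym quot_ker_sg[OF quot_ker_rcomm]])
      then show "l y (r a (sing x)) - sg (mpar par y \<and> mpar par a) (r a (l y (sing x))) - (r (MNode y a) (sing x) - r y (r a (sing x))) \<in> quot_ker"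
        unfolding l_single r_single l_linear r_linear
        by (cases "mpar par y"; cases "mpar par x"; cases "mpar par a") (simp_all add: algebra_simps)
    qed (simp_all add: l_linear r_linear sg_add sg_linear pm.scale_right_diff_distrib algebra_simps)
    then show "P (l y (P (r a f))) - sg (mpar par y \<and> mpar par a) (P (r a (P (l y f)))) = P (r (MNode y a) f) - P (r y (P (r a f)))"
      unfolding Pl Pr by (simp add: P_sg[symmetric] P_diff[symmetric] P_eq)
  next
    fix a b f
    have "r a (r b f) - sg (mpar par a \<and> mpar par b) (r b (r a f)) \<in> quot_ker"
    proof (rule in_quot_ker[of "\<lambda>f. r a (r b f) - sg (mpar par a \<and> mpar par b) (r b (r a f))"])
      fix x
      have "sg ((mpar par b \<and> mpar par x) \<noteq> (mpar par a \<and> (mpar par x \<noteq> mpar par b))) (sing (MNode (MNode x b) a)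
        - sg (mpar par b \<and> mpar par a) (sing (MNode (MNode x a) b))) \<in> quot_ker"
        by (intro quot_ker_sg quot_ker_rcomm)
      then show "r a (r b (sing x)) - sg (mpar par a \<and> mpar par b) (r b (r a (sing x))) \<in> quot_ker"
        unfolding r_single r_linear
        by (cases "mpar par b"; cases "mpar par x"; cases "mpar par a")
          (simp_all add: minus_diff_commute[of "sing (MNode (MNode x a) b)" "sing (MNode (MNode x b) a)"])
    qed (simp_all add: r_linear sg_add sg_linear pm.scale_right_diff_distrib algebra_simps)
    then show "P (r a (P (r b f))) = sg (mpar par a \<and> mpar par b) (P (r b (P (r a f))))"
      unfolding Pr by (simp add: P_sg[symmetric] P_eq)
  next
    fix y z f
    have "l y (l z f) - l (MNode y z) f - sg (mpar par y \<and> mpar par z) (l z (l y f) - l (MNode z y) f) \<in> quot_ker"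
    proof (rule in_quot_ker[of "\<lambda>f. l y (l z f) - l (MNode y z) f - sg (mpar par y \<and> mpar par z) (l z (l y f) - l (MNode z y) f)"])
      fix x
      show "l y (l z (sing x)) - l (MNode y z) (sing x) - sg (mpar par y \<and> mpar par z) (l z (l y (sing x)) - l (MNode z y) (sing x)) \<in> quot_ker"
        unfolding l_single by (rule quot_ker_lsym)
    qed (simp_all add: l_linear sg_add sg_diff sg_linear pm.scale_right_diff_distrib algebra_simps)
    then show "P (l y (P (l z f))) - P (l (MNode y z) f) = sg (mpar par y \<and> mpar par z) (P (l z (P (l y f))) - P (l (MNode z y) f))"
      unfolding Pl by (simp add: P_sg[symmetric] P_diff[symmetric] P_eq)
  qed
  moreover have "pm.lext (\<lambda>t. P (sing t)) f = P f" for f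
    using pm.additive_lext[of P sing f] P by (simp add: lin_ext_single_id)
  ultimately show thesis using that[of P] P(3) unfolding l_def r_def by blast
qed

text \<open>\<open>P\<close> vanishes on \<open>S\<close>, so \<open>phi_in_ads_IdD\<close> yields
  \<open>P f = 0\<close>. For \<open>f\<close> over \<open>X\<close> the restriction is the
  identity, and this is membership in the ideal.\<close>

lemma gdn_Id_phi:
  assumes S_sub: "S \<subseteq> mag_alg X" and f: "f \<in> mag_alg X" and phi: "phi f \<in> ads_IdD X par (phi ` S)"
  shows "f \<in> gdn_Id X par S"
proof -
  obtain P where P: "\<And>f. P f = 0 \<longleftrightarrow> f \<in> quot_ker"
    "gdn_operators lsmult par (\<lambda>t. P (sing t)) (\<lambda>y f. P (mmul (sing y) f))
       (\<lambda>a f. P (mmul (twist par (mpar par a) f) (sing a)))"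
    "\<And>f. pm.lext (\<lambda>t. P (sing t)) f = P f"
    by (rule quotient_operators) blast
  have "(\<exists>i. mhom par i s) \<and> P s = 0" if "s \<in> S" for s
  proof -
    have "restr X s = s" using that S_sub by (intro restr_id) blast
    then show ?thesis
      using that S_homog unfolding P quot_ker_def gdn_Id_def by (auto intro: gen_ideal.gen)
  qed
  then have "P f = 0"
    using gdn_operators.phi_in_ads_IdD[OF P(2), of S f X] phi unfolding P(3) by blast
  then show ?thesis using restr_id[OF f] by (simp add: P quot_ker_def)
qed

end

text \<open>Both quotients are given by the preimages of their ideals in free term algebras, so the
  last equivalence expresses at once that the induced map is well defined and injective.\<close>

theorem theorem3p8:
  fixes X :: "'x set" and par :: "'x \<Rightarrow> bool" and wo :: "'x rel"
    and S :: "('x mag \<Rightarrow>\<^sub>0 'k::field) set"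
  assumes char: "(2::'k) \<noteq> 0"
    and wellord: "well_order_on X wo"
    and S_sub: "S \<subseteq> mag_alg X"
    and S_homog: "\<forall>s\<in>S. \<exists>i. mhom par i s"
  shows "(\<forall>f g :: 'x mag \<Rightarrow>\<^sub>0 'k. phi (f + g) = phi f + phi g)
       \<and> (\<forall>(c::'k) (f :: 'x mag \<Rightarrow>\<^sub>0 'k). phi (lsmult c f) = lsmult c (phi f))
       \<and> (\<forall>i (f :: 'x mag \<Rightarrow>\<^sub>0 'k). mhom par i f \<longrightarrow> dhom par i (phi f))
       \<and> (\<forall>f g :: 'x mag \<Rightarrow>\<^sub>0 'k. phi (mmul f g) = dmul (phi f) (dder (phi g)))
       \<and> (\<forall>f\<in>mag_alg X. f \<in> gdn_Id X par S \<longleftrightarrow> phi f \<in> ads_IdD X par (phi ` S))"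
  using phi_linear(1,4) dhom_phi phi_mmul phi_gdn_Id gdn_Id_phi[OF S_homog S_sub]
  by blast

end
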